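(* Let $\mathcal{C}$ be a class of graphs of bounded expansion and let $r\geq 2$ be an integer. Then the class $\{G^r\colon G\in \mathcal{C}\}$ of $r$th powers of graphs from $\mathcal{C}$ admits low rank-width colorings.
   Context: All graphs are finite, undirected and simple. The $r$th power $G^r$ of a graph $G$ has vertex set $V(G)$, with $u\neq v$ adjacent iff their distance in $G$ is at most $r$. A class $\mathcal{C}$ of graphs has bounded expansion if for every integer $r\ge 0$ there is a constant $c(r)$ such that every graph $H$ that is a depth-$r$ minor of a graph in $\mathcal{C}$ (i.e. obtained by contracting pairwise disjoint connected subgraphs of radius at most $r$ of a subgraph) satisfies $|E(H)|\le c(r)\,|V(H)|$. Rank-width: for a graph $G$ and $X\subseteq V(G)$, $\mathrm{cutrk}_G(X)$ is the rank over the binary field of the adjacency submatrix with rows $X$ and columns $V(G)\setminus X$ (zero if $X=\emptyset$ or $X=V(G)$). A rank-decomposition of $G$ is a pair $(T,L)$ with $T$ a tree with at least two nodes all of degree $1$ or $3$ and $L$ a bijection from $V(G)$ to the leaves of $T$; the width of an edge $e$ of $T$ is $\mathrm{cutrk}_G(A_e)$ where $A_e$ is the set of vertices mapped to the leaves of one component of $T-e$; the width of $(T,L)$ is the maximum width of its edges, and the rank-width of $G$ is the minimum width of a rank-decomposition (and $0$ if $|V(G)|\le 1$). A class $\mathcal{D}$ of graphs admits low rank-width colorings if there exist functions $N,Q\colon\mathbb{N}\to\mathbb{N}$ such that for all $p\in\mathbb{N}$, every $G\in\mathcal{D}$ can be vertex colored with at most $N(p)$ colors such that the union of any $i\le p$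 color classes induces a subgraph of rank-width at most $Q(i)$. *)

theory Defs
  imports Complex_Main "HOL-Library.Extended_Nat" "HOL-Library.Function_Algebras" "HOL-Library.Z2"
begin

section \<open>Finite simple graphs\<close>

datatype 'a graph = Graph (vertices: "'a set") (edges: "'a set set")

definition simple_graph :: "'a graph \<Rightarrow> bool" where
  "simple_graph G \<longleftrightarrow>
     finite (vertices G) \<and> (\<forall>e\<in>edges G. e \<subseteq> vertices G \<and> card e = 2)"

definition subgraph :: "'a graph \<Rightarrow> 'a graph \<Rightarrow> bool" where
  "subgraph S G \<longleftrightarrow>
     simple_graph S \<and> vertices S \<subseteq> vertices G \<and> edges S \<subseteq> edges G"

definition induced_subgraph :: "'a graph \<Rightarrow> 'a set \<Rightarrow> 'a graph" where
  "induced_subgraph G X = Graph (vertices G \<inter> X) {e \<in> edges G. e \<subseteq> X}"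

definition delete_edge :: "'a graph \<Rightarrow> 'a set \<Rightarrow> 'a graph" where
  "delete_edge G e = Graph (vertices G) (edges G - {e})"

definition degree :: "'a graph \<Rightarrow> 'a \<Rightarrow> nat" where
  "degree G v = card {e \<in> edges G. v \<in> e}"

section \<open>Walks, distance, powers\<close>

definition walk :: "'a graph \<Rightarrow> 'a list \<Rightarrow> bool" where
  "walk G p \<longleftrightarrow>
     p \<noteq> [] \<and> set p \<subseteq> vertices G \<and> successively (\<lambda>u v. {u, v} \<in> edges G) p"

definition walks_between :: "'a graph \<Rightarrow> 'a \<Rightarrow> 'a \<Rightarrow> 'a list set" where
  "walks_between G u v = {p. walk G p \<and> hd p = u \<and> last p = v}"

text \<open>The distance is \<open>\<infinity>\<close> (the infimum of the empty set) when no walk exists.\<close>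

definition gdist :: "'a graph \<Rightarrow> 'a \<Rightarrow> 'a \<Rightarrow> enat" where
  "gdist G u v = (INF p\<in>walks_between G u v. enat (length p - 1))"

definition graph_power :: "'a graph \<Rightarrow> nat \<Rightarrow> 'a graph" where
  "graph_power G r = Graph (vertices G)
     {{u, v} | u v. u \<in> vertices G \<and> v \<in> vertices G \<and> u \<noteq> v \<and> gdist G u v \<le> enat r}"

definition connected_graph :: "'a graph \<Rightarrow> bool" where
  "connected_graph G \<longleftrightarrow>
     vertices G \<noteq> {} \<and> (\<forall>u\<in>vertices G. \<forall>v\<in>vertices G. walks_between G u v \<noteq> {})"

definition radius :: "'a graph \<Rightarrow> enat" where
  "radius G = (INF c\<in>vertices G. SUP v\<in>vertices G. gdist G c v)"

definition components :: "'a graph \<Rightarrow> 'a set set" where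
  "components G = {{v \<in> vertices G. walks_between G u v \<noteq> {}} | u. u \<in> vertices G}"

definition is_cycle :: "'a graph \<Rightarrow> 'a list \<Rightarrow> bool" where
  "is_cycle G p \<longleftrightarrow>
     walk G p \<and> distinct p \<and> length p \<ge> 3 \<and> {last p, hd p} \<in> edges G"

definition is_tree :: "'a graph \<Rightarrow> bool" where
  "is_tree G \<longleftrightarrow> simple_graph G \<and> connected_graph G \<and> (\<nexists>p. is_cycle G p)"

section \<open>Bounded expansion\<close>

text \<open>
  \<open>H\<close> arises from a subgraph \<open>S\<close> by a contraction map \<open>\<phi>\<close> whose fibres are the contracted vertex
  sets (vertices that are not contracted form singleton fibres, of radius \<open>0\<close>).
\<close>

definition depth_minor :: "nat \<Rightarrow> 'b graph \<Rightarrow> 'a graph \<Rightarrow> bool" where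
  "depth_minor r H G \<longleftrightarrow>
     (\<exists>S \<phi>. subgraph S G \<and> vertices H = \<phi> ` vertices S \<and>
        edges H = {{\<phi> u, \<phi> v} | u v. {u, v} \<in> edges S \<and> \<phi> u \<noteq> \<phi> v} \<and>
        (\<forall>h\<in>vertices H.
           connected_graph (induced_subgraph S {v. \<phi> v = h}) \<and>
           radius (induced_subgraph S {v. \<phi> v = h}) \<le> enat r))"

text \<open>
  It suffices to let \<open>H\<close> range over graphs with vertices in the type of the vertices of \<open>G\<close>: each
  contracted vertex set can be named by one of its members, so every depth-\<open>r\<close> minor of \<open>G\<close> has an
  isomorphic copy there.
\<close>

definition bounded_expansion :: "'a graph set \<Rightarrow> bool" where
  "bounded_expansion C \<longleftrightarrow>
     (\<forall>r. \<exists>c::real. \<forall>G\<in>C. \<forall>H::'a graph. depth_minor r H G \<longrightarrow>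
        real (card (edges H)) \<le> c * real (card (vertices H)))"

section \<open>Cut-rank and rank-width\<close>

definition scale_fun :: "bit \<Rightarrow> ('a \<Rightarrow> bit) \<Rightarrow> 'a \<Rightarrow> bit" where
  "scale_fun c f = (\<lambda>v. c * f v)"

lemma vector_space_scale_fun: "vector_space scale_fun"
  by standard (auto simp: scale_fun_def fun_eq_iff algebra_simps)

text \<open>
  A row of the adjacency submatrix is a function of the columns, extended by zero outside
  \<open>vertices G - X\<close>.  The rank of the matrix is the dimension over the binary field of the space
  spanned by its rows; in particular it is \<open>0\<close> for \<open>X = {}\<close> and for \<open>X = vertices G\<close>.
\<close>

definition cut_row :: "'a graph \<Rightarrow> 'a set \<Rightarrow> 'a \<Rightarrow> 'a \<Rightarrow> bit" where
  "cut_row G X u = (\<lambda>v. if v \<in> vertices G - X \<and> {u, v} \<in> edges G then 1 else 0)"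

definition cutrk :: "'a graph \<Rightarrow> 'a set \<Rightarrow> nat" where
  "cutrk G X = vector_space.dim scale_fun (cut_row G X ` X)"

definition leaves :: "'a graph \<Rightarrow> 'a set" where
  "leaves T = {t \<in> vertices T. degree T t = 1}"

definition rank_decomposition :: "'a graph \<Rightarrow> nat graph \<Rightarrow> ('a \<Rightarrow> nat) \<Rightarrow> bool" where
  "rank_decomposition G T L \<longleftrightarrow>
     is_tree T \<and> card (vertices T) \<ge> 2 \<and> (\<forall>t\<in>vertices T. degree T t \<in> {1, 3}) \<and>
     bij_betw L (vertices G) (leaves T)"

text \<open>
  The two components of \<open>T - e\<close> give complementary vertex sets of \<open>G\<close>, which have the same
  cut-rank, so the maximum may be taken over both.
\<close>

definition decomposition_width :: "'a graph \<Rightarrow> nat graph \<Rightarrow> ('a \<Rightarrow> nat) \<Rightarrow> nat" where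
  "decomposition_width G T L =
     Max {cutrk G {v \<in> vertices G. L v \<in> K} | e K.
            e \<in> edges T \<and> K \<in> components (delete_edge T e)}"

definition rank_width :: "'a graph \<Rightarrow> nat" where
  "rank_width G =
     (if card (vertices G) \<le> 1 then 0
      else (LEAST k. \<exists>T L. rank_decomposition G T L \<and> decomposition_width G T L = k))"

section \<open>Low rank-width colorings\<close>

definition low_rank_width_colorings :: "'a graph set \<Rightarrow> bool" where
  "low_rank_width_colorings D \<longleftrightarrow>
     (\<exists>N Q :: nat \<Rightarrow> nat. \<forall>p. \<forall>G\<in>D. \<exists>col :: 'a \<Rightarrow> nat.
        col ` vertices G \<subseteq> {..<N p} \<and>
        (\<forall>I. I \<subseteq> {..<N p} \<and> card I \<le> p \<longrightarrow>
           rank_width (induced_subgraph G {v \<in> vertices G. col v \<in> I}) \<le> Q (card I)))"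

end

theory Submission
  imports Defs "HOL-Library.FuncSet"
begin

text \<open>
  Low rank-width colourings come from weak reachability. In a class of bounded expansion, every
  nonempty vertex set \<open>S\<close> has a vertex with only boundedly many short walks to other vertices of \<open>S\<close>
  that are otherwise disjoint and avoid \<open>S\<close>: else take a maximal packing of short paths between
  vertices of \<open>S\<close> and an independent set \<open>I\<close> of the minor on \<open>S\<close> formed by these paths; contracting
  the balls around \<open>I\<close> that avoid the packing yields a shallow minor with too many edges. Removing
  such vertices one after another gives, for every length, an order of the vertices in which every
  vertex weakly reaches a bounded number of vertices.

  With one order, every vertex \<open>u\<close> gets a bounded closure that contains shortest paths to the
  vertices it weakly \<open>r\<close>-reaches, so that distances up to \<open>r\<close> between vertices of \<open>X\<close> are kept in the
  union \<open>Y\<close> of the closures over \<open>X\<close>. With a second order, for a much larger length, colour the graph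
  so that vertices weakly reachable from each other differ, and recolour \<open>u\<close> by the set of colours on
  its closure. If \<open>X\<close> has few new colours then \<open>Y\<close> has few old ones, so paths in \<open>Y\<close> are short and
  the second order eliminates \<open>G[Y]\<close> with boundedly many ancestors for every vertex. This elimination
  forest splits \<open>X\<close> along separators of bounded size, and a vertex enters a row of a cut matrix of
  \<open>G\<^sup>r[X]\<close> only through its distances up to \<open>r\<close> to such a separator, so the cut-rank is bounded.
  The product of the colourings for all \<open>i \<le> p\<close> gives a width bound that depends on \<open>i\<close> alone.
\<close>

section \<open>Walks of bounded length inside a vertex set\<close>

text \<open>\<open>n\<close> bounds the length from above, because \<open>refl\<close> leaves it
  free. Every vertex of the walk, the ends included, lies in \<open>A\<close>, so the relation is
  monotone in both parameters.\<close>

inductive linked :: "'a graph \<Rightarrow> 'a set \<Rightarrow> nat \<Rightarrow> 'a \<Rightarrow> 'a \<Rightarrow> bool" for G A where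
  refl: "u \<in> A \<Longrightarrow> linked G A n u u"
| step: "{u, w} \<in> edges G \<Longrightarrow> u \<in> A \<Longrightarrow> linked G A n w v \<Longrightarrow> linked G A (Suc n) u v"

lemma linked_in:
  assumes "linked G A n u v"
  shows "u \<in> A" "v \<in> A"
  using assms by (induction) auto

lemma linked_mono:
  assumes "linked G A n u v" "n \<le> m" "A \<subseteq> B"
  shows "linked G B m u v"
  using assms(1,2)
proof (induction arbitrary: m)
  case (refl u n)
  then show ?case using assms(3) by (auto intro: linked.refl)
next
  case (step u w n v)
  then obtain m' where "m = Suc m'" "n \<le> m'" by (cases m) auto
  then show ?case using step assms(3) by (auto intro: linked.step)
qed

lemma linked_trans:
  assumes "linked G A n u v" "linked G A m v w"
  shows "linked G A (n + m) u w"
  using assms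
proof (induction)
  case (refl u n)
  then show ?case by (auto intro: linked_mono)
next
  case (step u x n v)
  then show ?case by (auto intro: linked.step)
qed

lemma linked_edge:
  assumes "{u, v} \<in> edges G" "u \<in> A" "v \<in> A"
  shows "linked G A (Suc 0) u v"
  using assms by (auto intro: linked.intros)

lemma linked_snoc:
  assumes "linked G A n u v" "{v, w} \<in> edges G" "w \<in> A"
  shows "linked G A (Suc n) u w"
  using linked_trans[OF assms(1) linked_edge[OF assms(2) _ assms(3)]] linked_in[OF assms(1)]
  by simp

lemma linked_sym:
  assumes "linked G A n u v"
  shows "linked G A n v u"
  using assms
proof (induction)
  case (refl u n)
  then show ?case by (rule linked.refl)
next
  case (step u w n v)
  then show ?case by (auto intro: linked_snoc simp: insert_commute)
qed

text \<open>The walk is cut at its first vertex in \<open>Z\<close>: the part before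
  \<open>z\<close> meets \<open>Z\<close> only there, and the rest is unrestricted in
  \<open>A\<close>.\<close>

lemma linked_first_hit:
  assumes "linked G A n u v" "\<not> linked G (A - Z) n u v"
  shows "\<exists>z\<in>Z. \<exists>i j. i + j \<le> n \<and> linked G (A - Z \<union> {z}) i u z \<and> linked G A j z v"
  using assms
proof (induction)
  case (refl u n)
  then have "u \<in> Z" by (auto intro: linked.refl)
  then show ?case using refl
    by (intro bexI[of _ u] exI[of _ 0]) (auto intro: linked.refl)
next
  case (step u w n v)
  show ?case
  proof (cases "u \<in> Z")
    case True
    have "linked G A (Suc n) u v" using step by (auto intro: linked.step)
    then show ?thesis using True
      by (intro bexI[of _ u] exI[of _ 0] exI[of _ "Suc n"]) (auto intro: linked.refl)
  next
    case False
    then have "\<not> linked G (A - Z) n w v" using step by (auto intro: linked.step)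
    then obtain z i j where "z \<in> Z" "i + j \<le> n" "linked G (A - Z \<union> {z}) i w z" "linked G A j z v"
      using step by blast
    moreover then have "linked G (A - Z \<union> {z}) (Suc i) u z"
      using step False by (auto intro: linked.step)
    ultimately show ?thesis by (intro bexI[of _ z] exI[of _ "Suc i"] exI[of _ j]) auto
  qed
qed

text \<open>The prefix stops one edge before \<open>Z\<close>, so the bound drops by exactly one;
  this saved step keeps the halves of packed paths within radius \<open>n\<close>.\<close>

lemma linked_before_hit:
  assumes "linked G A n u v" "u \<notin> Z" "v \<in> Z"
  shows "\<exists>y z m. n = Suc m \<and> z \<in> Z \<and> z \<in> A \<and> {y, z} \<in> edges G \<and> linked G (A - Z) m u y"
  using assms
proof (induction)
  case (step u w n v)
  show ?case
  proof (cases "w \<in> Z")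
    case True
    then show ?thesis using step linked_in[OF step(3)]
      by (intro exI[of _ u] exI[of _ w] exI[of _ n]) (auto intro: linked.refl)
  next
    case False
    then obtain y z m where *: "n = Suc m" "z \<in> Z" "z \<in> A" "{y, z} \<in> edges G" "linked G (A - Z) m w y"
      using step by blast
    then have "linked G (A - Z) (Suc m) u y" using step by (auto intro: linked.step)
    then show ?thesis using * by blast
  qed
qed auto

text \<open>\<open>B\<close> consists of the vertices of one walk. The last conclusion makes it
  usable as a contracted set with centre \<open>u\<close>.\<close>

lemma linked_path:
  assumes "linked G A n u v"
  obtains B where "B \<subseteq> A" "finite B" "card B \<le> Suc n" "linked G B n u v" "u \<in> B" "v \<in> B"
    "\<And>x. x \<in> B \<Longrightarrow> linked G B n u x"
proof -
  have "\<exists>B\<subseteq>A. finite B \<and> card B \<le> Suc n \<and> linked G B n u v \<and> (\<forall>x\<in>B. linked G B n u x)"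
    using assms
  proof (induction)
    case (refl u n)
    then show ?case by (intro exI[of _ "{u}"]) (auto intro: linked.refl)
  next
    case (step u w n v)
    then obtain B where B: "B \<subseteq> A" "finite B" "card B \<le> Suc n" "linked G B n w v"
      "\<forall>x\<in>B. linked G B n w x" by (elim exE conjE)
    have *: "linked G (insert u B) (Suc n) u x" if "x \<in> B" for x
    proof (rule linked.step[OF step(1)])
      show "linked G (insert u B) n w x" using B that by (auto intro: linked_mono)
    qed auto
    moreover have "linked G (insert u B) (Suc n) u u" by (auto intro: linked.refl)
    moreover have "card (insert u B) \<le> Suc (Suc n)" using B(2,3) by (simp add: card_insert_if)
    moreover have "linked G (insert u B) (Suc n) u v" by (rule *[OF linked_in(2)[OF B(4)]])
    ultimately show ?case using B(1,2) step(2) *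
      by (intro exI[of _ "insert u B"]) simp
  qed
  then obtain B where B: "B \<subseteq> A" "finite B" "card B \<le> Suc n" "linked G B n u v"
    "\<And>x. x \<in> B \<Longrightarrow> linked G B n u x" by auto
  show thesis using linked_in[OF B(4)] by (intro that[OF B(1-4)] B(5))
qed

text \<open>The vertex of least label on the walk splits it into two parts that stay at or above
  that label, so both ends weakly reach it.\<close>

lemma linked_min:
  fixes L :: "'a \<Rightarrow> nat"
  assumes "linked G A n u v"
  shows "\<exists>m i j. i + j \<le> n \<and> linked G {x \<in> A. L m \<le> L x} i u m \<and> linked G {x \<in> A. L m \<le> L x} j m v"
  using assms
proof (induction)
  case (refl u n)
  then show ?case by (intro exI[of _ u] exI[of _ 0]) (auto intro: linked.refl)
next
  case (step u w n v)
  then obtain m i j where *: "i + j \<le> n" "linked G {x \<in> A. L m \<le> L x} i w m"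
    "linked G {x \<in> A. L m \<le> L x} j m v" by blast
  show ?case
  proof (cases "L m \<le> L u")
    case True
    then have "linked G {x \<in> A. L m \<le> L x} (Suc i) u m" using * step by (auto intro: linked.step)
    then show ?thesis using * by (intro exI[of _ m] exI[of _ "Suc i"] exI[of _ j]) auto
  next
    case False
    have "linked G {x \<in> A. L m \<le> L x} n w v"
      by (rule linked_mono[OF linked_trans[OF *(2,3)] *(1) order_refl])
    then have "linked G {x \<in> A. L u \<le> L x} n w v" using False by (auto elim!: linked_mono)
    then have "linked G {x \<in> A. L u \<le> L x} (Suc n) u v" using step by (auto intro: linked.step)
    then show ?thesis using step(2)
      by (intro exI[of _ u] exI[of _ 0] exI[of _ "Suc n"]) (auto intro: linked.refl)
  qed
qed

text \<open>All vertices of the walk lie in the ball themselves, so a ball has radius at most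
  \<open>n\<close> within its own vertex set.\<close>

lemma linked_ball:
  assumes "linked G A n u v"
  shows "linked G {x. linked G A n u x} n u v"
proof -
  obtain B where B: "B \<subseteq> A" "linked G B n u v" "\<And>x. x \<in> B \<Longrightarrow> linked G B n u x"
    by (rule linked_path[OF assms]) auto
  then have "B \<subseteq> {x. linked G A n u x}" by (auto intro: linked_mono)
  then show ?thesis by (rule linked_mono[OF B(2) order_refl])
qed

section \<open>Walks as vertex lists, and distance\<close>

lemma walk_Cons:
  "walk G (u # p) \<longleftrightarrow> u \<in> vertices G \<and> (p = [] \<or> {u, hd p} \<in> edges G \<and> walk G p)"
  by (cases p) (auto simp: walk_def)

lemma walk_append:
  "p \<noteq> [] \<Longrightarrow> q \<noteq> [] \<Longrightarrow>
    walk G (p @ q) \<longleftrightarrow> walk G p \<and> walk G q \<and> {last p, hd q} \<in> edges G"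
  by (auto simp: walk_def successively_append_iff)

lemma walk_linked:
  assumes "walk G p"
  shows "linked G (set p) (length p - 1) (hd p) (last p)"
  using assms
proof (induction p)
  case (Cons u p)
  show ?case
  proof (cases "p = []")
    case False
    then have "linked G (set (u # p)) (length p - 1) (hd p) (last p)"
      using Cons by (auto simp: walk_Cons intro: linked_mono)
    moreover have "{u, hd p} \<in> edges G" using Cons False by (simp add: walk_Cons)
    ultimately have "linked G (set (u # p)) (Suc (length p - 1)) u (last p)"
      by (auto intro: linked.step)
    then show ?thesis using False by simp
  qed (auto intro: linked.refl)
qed (auto simp: walk_def)

lemma linked_walk:
  assumes "linked G A n u v" "A \<subseteq> vertices G"
  shows "\<exists>p. walk G p \<and> hd p = u \<and> last p = v \<and> set p \<subseteq> A \<and> length p \<le> Suc n"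
  using assms(1)
proof (induction)
  case (refl u n)
  then show ?case using assms(2) by (intro exI[of _ "[u]"]) (auto simp: walk_Cons)
next
  case (step u w n v)
  then obtain p where p: "walk G p" "hd p = w" "last p = v" "set p \<subseteq> A" "length p \<le> Suc n" by blast
  moreover have "p \<noteq> []" using p(1) by (simp add: walk_def)
  moreover have "walk G (u # p)" using p step assms(2) by (auto simp: walk_Cons)
  ultimately show ?case using step by (intro exI[of _ "u # p"]) auto
qed

lemma gdist_le_iff:
  "gdist G u v \<le> enat n \<longleftrightarrow> linked G (vertices G) n u v"
proof
  assume "gdist G u v \<le> enat n"
  \<comment> \<open>Only a strict bound on the infimum yields a walk as witness.\<close>
  then have "gdist G u v < enat (Suc n)" by (metis enat_ord_simps(2) lessI order_le_less_trans)
  then obtain p where p: "p \<in> walks_between G u v" "enat (length p - 1) < enat (Suc n)"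
    by (auto simp: gdist_def INF_less_iff)
  then have "linked G (set p) (length p - 1) u v" "set p \<subseteq> vertices G"
    using walk_linked[of G p] by (auto simp: walks_between_def walk_def)
  then show "linked G (vertices G) n u v" using p(2) by (auto elim!: linked_mono)
next
  assume "linked G (vertices G) n u v"
  then obtain p where p: "walk G p" "hd p = u" "last p = v" "length p \<le> Suc n"
    using linked_walk[OF _ order_refl] by metis
  then have "gdist G u v \<le> enat (length p - 1)"
    unfolding gdist_def by (intro INF_lower) (auto simp: walks_between_def)
  also have "\<dots> \<le> enat n" using p by auto
  finally show "gdist G u v \<le> enat n" .
qed

lemma walks_between_nonempty_iff:
  "walks_between G u v \<noteq> {} \<longleftrightarrow> (\<exists>n. linked G (vertices G) n u v)"
proof
  assume "walks_between G u v \<noteq> {}"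
  then obtain p where "walk G p" "hd p = u" "last p = v" by (auto simp: walks_between_def)
  then have "linked G (vertices G) (length p - 1) u v"
    using walk_linked[of G p] by (auto simp: walk_def intro: linked_mono)
  then show "\<exists>n. linked G (vertices G) n u v" by blast
next
  assume "\<exists>n. linked G (vertices G) n u v"
  then obtain p where "walk G p" "hd p = u" "last p = v"
    using linked_walk[OF _ order_refl] by metis
  then show "walks_between G u v \<noteq> {}" by (auto simp: walks_between_def)
qed

lemma linked_induced:
  assumes "linked G A n u v" "A \<subseteq> B"
  shows "linked (induced_subgraph G B) A n u v"
  using assms(1)
proof (induction)
  case (step u w n v)
  moreover have "w \<in> A" using step linked_in by metis
  ultimately show ?case using assms(2)
    by (auto intro!: linked.step[of u w] simp: induced_subgraph_def)
qed (rule linked.refl)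

section \<open>Bounding the number of edges of a shallow minor\<close>

text \<open>The subgraph induced by \<open>V0\<close> is contracted along \<open>\<phi>\<close>. The
  vertex \<open>x\<close> of a fibre serves as its centre: walks through \<open>x\<close> connect
  the fibre, and the distances from \<open>x\<close> bound its radius.\<close>

lemma depth_minor_of_map:
  assumes G: "simple_graph G" and V0: "V0 \<subseteq> vertices G"
    and fibre: "\<And>h. h \<in> \<phi> ` V0 \<Longrightarrow>
      \<exists>x\<in>V0. \<phi> x = h \<and> (\<forall>y\<in>V0. \<phi> y = h \<longrightarrow> linked G {z \<in> V0. \<phi> z = h} d x y)"
  shows "depth_minor d (Graph (\<phi> ` V0)
    {{\<phi> u, \<phi> v} | u v. u \<in> V0 \<and> v \<in> V0 \<and> {u, v} \<in> edges G \<and> \<phi> u \<noteq> \<phi> v}) G"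
  unfolding depth_minor_def
proof (intro exI conjI ballI)
  let ?S = "induced_subgraph G V0"
  have VS: "vertices ?S = V0" using V0 by (auto simp: induced_subgraph_def)
  show "subgraph ?S G"
    using G V0 by (auto simp: subgraph_def simple_graph_def induced_subgraph_def intro: finite_subset)
  show "vertices (Graph (\<phi> ` V0)
    {{\<phi> u, \<phi> v} | u v. u \<in> V0 \<and> v \<in> V0 \<and> {u, v} \<in> edges G \<and> \<phi> u \<noteq> \<phi> v}) = \<phi> ` vertices ?S"
    using VS by simp
  show "edges (Graph (\<phi> ` V0)
    {{\<phi> u, \<phi> v} | u v. u \<in> V0 \<and> v \<in> V0 \<and> {u, v} \<in> edges G \<and> \<phi> u \<noteq> \<phi> v}) =
    {{\<phi> u, \<phi> v} | u v. {u, v} \<in> edges ?S \<and> \<phi> u \<noteq> \<phi> v}"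
    by (auto simp: induced_subgraph_def)
  fix h
  assume "h \<in> vertices (Graph (\<phi> ` V0)
    {{\<phi> u, \<phi> v} | u v. u \<in> V0 \<and> v \<in> V0 \<and> {u, v} \<in> edges G \<and> \<phi> u \<noteq> \<phi> v})"
  then obtain x where x: "x \<in> V0" "\<phi> x = h"
    "\<And>y. y \<in> V0 \<Longrightarrow> \<phi> y = h \<Longrightarrow> linked G {z \<in> V0. \<phi> z = h} d x y" using fibre by fastforce
  let ?R = "induced_subgraph ?S {v. \<phi> v = h}"
  have R: "?R = induced_subgraph G {z \<in> V0. \<phi> z = h}" and VR: "vertices ?R = {z \<in> V0. \<phi> z = h}"
    using V0 by (auto simp: induced_subgraph_def)
  have link: "linked ?R (vertices ?R) d x y" if "y \<in> vertices ?R" for y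
    unfolding VR unfolding R using x(3)[of y] that VR by (intro linked_induced) auto
  have "walks_between ?R u v \<noteq> {}" if "u \<in> vertices ?R" "v \<in> vertices ?R" for u v
    using linked_trans[OF linked_sym[OF link[OF that(1)]] link[OF that(2)]]
    unfolding walks_between_nonempty_iff by blast
  then show "connected_graph ?R" using x VR by (auto simp: connected_graph_def)
  have "radius ?R \<le> (SUP v\<in>vertices ?R. gdist ?R x v)"
    unfolding radius_def using x VR by (intro INF_lower) auto
  also have "\<dots> \<le> enat d" using link by (intro SUP_least) (simp add: gdist_le_iff)
  finally show "radius ?R \<le> enat d" .
qed

text \<open>The form in which bounded expansion is used: one natural constant for the depth
  \<open>d\<close>, and a contradiction needs to exhibit only a contraction map and some set
  \<open>F\<close> of edges of the minor.\<close>

lemma bounded_expansion_minor_bound: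
  fixes C :: "'a graph set"
  assumes "\<And>G. G \<in> C \<Longrightarrow> simple_graph G" "bounded_expansion C"
  obtains c :: nat where "\<And>G V0 (\<phi> :: 'a \<Rightarrow> 'a) F. \<lbrakk>G \<in> C; V0 \<subseteq> vertices G;
      F \<subseteq> {{\<phi> u, \<phi> v} | u v. u \<in> V0 \<and> v \<in> V0 \<and> {u, v} \<in> edges G \<and> \<phi> u \<noteq> \<phi> v};
      \<And>h. h \<in> \<phi> ` V0 \<Longrightarrow>
        \<exists>x\<in>V0. \<phi> x = h \<and> (\<forall>y\<in>V0. \<phi> y = h \<longrightarrow> linked G {z \<in> V0. \<phi> z = h} d x y)\<rbrakk>
    \<Longrightarrow> card F \<le> c * card (\<phi> ` V0)"
proof -
  obtain c :: real where c: "\<And>G (H :: 'a graph). G \<in> C \<Longrightarrow> depth_minor d H G \<Longrightarrow>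
      real (card (edges H)) \<le> c * real (card (vertices H))"
    using assms(2) unfolding bounded_expansion_def by meson
  show thesis
  proof (rule that[of "nat \<lceil>c\<rceil>"])
    fix G V0 F and \<phi> :: "'a \<Rightarrow> 'a"
    assume G: "G \<in> C" and V0: "V0 \<subseteq> vertices G"
      and F: "F \<subseteq> {{\<phi> u, \<phi> v} | u v. u \<in> V0 \<and> v \<in> V0 \<and> {u, v} \<in> edges G \<and> \<phi> u \<noteq> \<phi> v}"
      and fibre: "\<And>h. h \<in> \<phi> ` V0 \<Longrightarrow>
        \<exists>x\<in>V0. \<phi> x = h \<and> (\<forall>y\<in>V0. \<phi> y = h \<longrightarrow> linked G {z \<in> V0. \<phi> z = h} d x y)"
    let ?E = "{{\<phi> u, \<phi> v} | u v. u \<in> V0 \<and> v \<in> V0 \<and> {u, v} \<in> edges G \<and> \<phi> u \<noteq> \<phi> v}"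
    have "finite V0" using assms(1)[OF G] V0 finite_subset by (auto simp: simple_graph_def)
    then have "finite ?E" by (intro finite_subset[of ?E "Pow (\<phi> ` V0)"]) auto
    then have "real (card F) \<le> real (card ?E)" using F by (simp add: card_mono)
    also have "\<dots> \<le> c * real (card (\<phi> ` V0))"
      using c[OF G depth_minor_of_map[OF assms(1)[OF G] V0 fibre]] by simp
    also have "\<dots> \<le> real (nat \<lceil>c\<rceil>) * real (card (\<phi> ` V0))"
      by (intro mult_right_mono) linarith+
    finally show "card F \<le> nat \<lceil>c\<rceil> * card (\<phi> ` V0)"
      by (metis of_nat_le_iff of_nat_mult)
  qed
qed

section \<open>Fans\<close>

text \<open>Density at most \<open>c\<close> on all subsets forces a vertex of degree at most
  \<open>2 * c\<close> in every nonempty subset. Taking it and discarding its closed neighbourhood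
  of at most \<open>2 * c + 1\<close> vertices builds \<open>I\<close> greedily.\<close>

lemma large_independent_set:
  fixes F :: "'a set set"
  assumes "finite S" "\<And>e. e \<in> F \<Longrightarrow> card e = 2"
    and "\<And>S'. S' \<subseteq> S \<Longrightarrow> card {e \<in> F. e \<subseteq> S'} \<le> c * card S'"
  shows "\<exists>I\<subseteq>S. (\<forall>e\<in>F. \<not> e \<subseteq> I) \<and> card S \<le> (2 * c + 1) * card I"
  using assms(1,3)
proof (induction "card S" arbitrary: S rule: less_induct)
  case less
  show ?case
  proof (cases "S = {}")
    case True
    then show ?thesis using assms(2)[of "{}"] by (intro exI[of _ "{}"]) auto
  next
    case False
    define FS where "FS = {e \<in> F. e \<subseteq> S}"
    have fFS: "finite FS" using less.prems(1) by (intro finite_subset[of FS "Pow S"]) (auto simp: FS_def)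
    have FSD: "e \<in> F" "e \<subseteq> S" "card e = 2" if "e \<in> FS" for e
      using that assms(2) by (auto simp: FS_def)
    \<comment> \<open>Otherwise the degree sum, which is \<open>2 * card FS\<close>, would exceed
      \<open>2 * c * card S\<close>.\<close>
    have "\<exists>v\<in>S. card {e \<in> FS. v \<in> e} \<le> 2 * c"
    proof (rule ccontr)
      assume "\<not> ?thesis"
      then have "(\<Sum>v\<in>S. 2 * c) < (\<Sum>v\<in>S. card {e \<in> FS. v \<in> e})"
        using False less.prems(1) by (intro sum_strict_mono) auto
      also have "\<dots> = (\<Sum>v\<in>S. \<Sum>e\<in>FS. if v \<in> e then 1 else 0)"
        using sum.inter_filter[OF fFS, of "\<lambda>_. 1 :: nat"] by (auto intro!: sum.cong)
      also have "\<dots> = (\<Sum>e\<in>FS. \<Sum>v\<in>S. if v \<in> e then 1 else 0)" by (rule sum.swap)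
      also have "\<dots> = (\<Sum>e\<in>FS. card e)"
      proof (rule sum.cong[OF HOL.refl])
        fix e assume "e \<in> FS"
        then have "{v \<in> S. v \<in> e} = e" using FSD by auto
        with sum.inter_filter[OF less.prems(1), of "\<lambda>_. 1 :: nat" "\<lambda>v. v \<in> e"] show "(\<Sum>v\<in>S. if v \<in> e then 1 else 0) = card e"
          by simp
      qed
      also have "\<dots> = 2 * card FS" using FSD by simp
      also have "\<dots> \<le> 2 * (c * card S)" using less.prems(2)[of S] by (simp add: FS_def)
      finally show False by simp
    qed
    then obtain v where v: "v \<in> S" "card {e \<in> FS. v \<in> e} \<le> 2 * c" by blast
    \<comment> \<open>The closed neighbourhood of \<open>v\<close> in the graph with edge set
      \<open>FS\<close>.\<close>
    define M where "M = insert v (\<Union>e\<in>{e \<in> FS. v \<in> e}. e - {v})"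
    have "card (\<Union>e\<in>{e \<in> FS. v \<in> e}. e - {v}) \<le> (\<Sum>e\<in>{e \<in> FS. v \<in> e}. card (e - {v}))"
      using fFS by (intro card_UN_le) auto
    also have "\<dots> = (\<Sum>e\<in>{e \<in> FS. v \<in> e}. 1)"
      by (intro sum.cong refl) (auto simp: FSD card_Diff_singleton)
    also have "\<dots> \<le> 2 * c" using v by simp
    finally have "card M \<le> 2 * c + 1"
      unfolding M_def using card_insert_le_m1[of "2 * c + 1"] by (metis add_diff_cancel_right' zero_less_Suc Suc_eq_plus1)
    moreover have "M \<subseteq> S" "v \<in> M" using v FSD by (auto simp: M_def)
    ultimately have M: "card M \<le> 2 * c + 1" "M \<subseteq> S" "v \<in> M" .
    have "S - M \<subset> S" using M v by auto
    then have "\<exists>I\<subseteq>S - M. (\<forall>e\<in>F. \<not> e \<subseteq> I) \<and> card (S - M) \<le> (2 * c + 1) * card I"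
      using less.prems by (intro less.hyps psubset_card_mono) auto
    then obtain I where I: "I \<subseteq> S - M" "\<forall>e\<in>F. \<not> e \<subseteq> I" "card (S - M) \<le> (2 * c + 1) * card I"
      by blast
    have fin: "finite M" "finite I"
      using finite_subset[OF M(2) less.prems(1)] finite_subset[OF I(1)] less.prems(1) by auto
    have "\<not> e \<subseteq> insert v I" if "e \<in> F" for e
    proof
      assume e: "e \<subseteq> insert v I"
      moreover have "v \<in> e" using e I that by blast
      ultimately have "e \<in> FS" "v \<in> e" using that I v by (auto simp: FS_def)
      then have "e - {v} \<subseteq> M" "e - {v} \<subseteq> I" using e by (auto simp: M_def)
      then have "e \<subseteq> {v}" using I by blast
      then have "card e \<le> 1" using card_mono[of "{v}" e] by simp
      then show False using assms(2)[OF that] by simp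
    qed
    moreover have "card S \<le> (2 * c + 1) * card (insert v I)"
    proof -
      have "card S = card (S - M) + card M"
        using M fin less.prems(1) by (simp add: card_Diff_subset card_mono)
      also have "\<dots> \<le> (2 * c + 1) * card I + (2 * c + 1)" using I M by linarith
      also have "\<dots> = (2 * c + 1) * card (insert v I)" using I M fin by (subst card_insert_disjoint) auto
      finally show ?thesis .
    qed
    ultimately show ?thesis using I v by (intro exI[of _ "insert v I"]) auto
  qed
qed

text \<open>\<open>P u\<close> holds the vertices other than \<open>v\<close> of a walk from \<open>v\<close> to \<open>u\<close>; the walks of a fan share
  only \<open>v\<close>.\<close>

definition fan :: "'a graph \<Rightarrow> nat \<Rightarrow> 'a set \<Rightarrow> 'a \<Rightarrow> 'a set \<Rightarrow> ('a \<Rightarrow> 'a set) \<Rightarrow> bool" where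
  "fan G n S v U P \<longleftrightarrow> finite U \<and> v \<notin> U \<and>
     (\<forall>u\<in>U. P u \<subseteq> vertices G \<and> card (P u) \<le> n \<and> P u \<inter> S = {u} \<and> linked G (insert v (P u)) n v u) \<and>
     (\<forall>u\<in>U. \<forall>u'\<in>U. u \<noteq> u' \<longrightarrow> P u \<inter> P u' = {})"

text \<open>\<open>H e u\<close> is the half, containing the end \<open>u\<close>, of a path that joins the two ends of \<open>e\<close>
  outside \<open>S\<close>.\<close>

definition packing :: "'a graph \<Rightarrow> nat \<Rightarrow> 'a set \<Rightarrow> 'a set set \<Rightarrow> ('a set \<Rightarrow> 'a \<Rightarrow> 'a set) \<Rightarrow> bool" where
  "packing G n S F H \<longleftrightarrow>
     (\<forall>e\<in>F. e \<subseteq> S \<and> card e = 2) \<and>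
     (\<forall>e\<in>F. \<forall>u\<in>e. H e u \<subseteq> vertices G \<and> H e u \<inter> S = {u} \<and> card (H e u) \<le> Suc n \<and>
        (\<forall>y\<in>H e u. linked G (H e u) n u y)) \<and>
     (\<forall>e\<in>F. \<forall>u\<in>e. \<forall>v\<in>e. u \<noteq> v \<longrightarrow> (\<exists>x\<in>H e u. \<exists>y\<in>H e v. {x, y} \<in> edges G)) \<and>
     (\<forall>e\<in>F. \<forall>e'\<in>F. \<forall>u\<in>e. \<forall>u'\<in>e'. (e, u) \<noteq> (e', u') \<longrightarrow> H e u \<inter> H e' u' \<subseteq> S)"

lemma packingD:
  assumes "packing G n S F H" "e \<in> F"
  shows "e \<subseteq> S" "card e = 2"
    and "u \<in> e \<Longrightarrow> H e u \<subseteq> vertices G" "u \<in> e \<Longrightarrow> H e u \<inter> S = {u}"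
      "u \<in> e \<Longrightarrow> card (H e u) \<le> Suc n"
    and "u \<in> e \<Longrightarrow> y \<in> H e u \<Longrightarrow> linked G (H e u) n u y"
    and "u \<in> e \<Longrightarrow> v \<in> e \<Longrightarrow> u \<noteq> v \<Longrightarrow> \<exists>x\<in>H e u. \<exists>y\<in>H e v. {x, y} \<in> edges G"
    and "e' \<in> F \<Longrightarrow> u \<in> e \<Longrightarrow> u' \<in> e' \<Longrightarrow> (e, u) \<noteq> (e', u') \<Longrightarrow> x \<in> H e u \<Longrightarrow> x \<in> H e' u' \<Longrightarrow> x \<in> S"
proof -
  note p = assms(1)[unfolded packing_def]
  note p1 = conjunct1[OF p] and p2 = conjunct1[OF conjunct2[OF p]]
    and p3 = conjunct1[OF conjunct2[OF conjunct2[OF p]]]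
    and p4 = conjunct2[OF conjunct2[OF conjunct2[OF p]]]
  show "e \<subseteq> S" "card e = 2" using p1 assms(2) by auto
  show "u \<in> e \<Longrightarrow> H e u \<subseteq> vertices G" "u \<in> e \<Longrightarrow> H e u \<inter> S = {u}"
    "u \<in> e \<Longrightarrow> card (H e u) \<le> Suc n" "u \<in> e \<Longrightarrow> y \<in> H e u \<Longrightarrow> linked G (H e u) n u y"
    using p2 assms(2) by auto
  show "u \<in> e \<Longrightarrow> v \<in> e \<Longrightarrow> u \<noteq> v \<Longrightarrow> \<exists>x\<in>H e u. \<exists>y\<in>H e v. {x, y} \<in> edges G"
    using p3 assms(2) by blast
  show "e' \<in> F \<Longrightarrow> u \<in> e \<Longrightarrow> u' \<in> e' \<Longrightarrow> (e, u) \<noteq> (e', u') \<Longrightarrow> x \<in> H e u \<Longrightarrow> x \<in> H e' u' \<Longrightarrow> x \<in> S"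
    using p4 assms(2) by blast
qed

section \<open>Packings of short paths\<close>

text \<open>Contracting each half to its end in \<open>S\<close> turns the path of \<open>e\<close>
  into the edge \<open>e\<close>, so the paths with both ends in \<open>S'\<close> form the edges of
  a depth-\<open>n\<close> minor on \<open>S'\<close>.\<close>

lemma packing_minor_bound:
  fixes G :: "'a graph"
  assumes S: "S \<subseteq> vertices G" and pack: "packing G n S F H"
    and c: "\<And>V0 (\<phi> :: 'a \<Rightarrow> 'a) F. \<lbrakk>V0 \<subseteq> vertices G;
      F \<subseteq> {{\<phi> u, \<phi> v} | u v. u \<in> V0 \<and> v \<in> V0 \<and> {u, v} \<in> edges G \<and> \<phi> u \<noteq> \<phi> v};
      \<And>h. h \<in> \<phi> ` V0 \<Longrightarrow>
        \<exists>x\<in>V0. \<phi> x = h \<and> (\<forall>y\<in>V0. \<phi> y = h \<longrightarrow> linked G {z \<in> V0. \<phi> z = h} n x y)\<rbrakk>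
    \<Longrightarrow> card F \<le> c * card (\<phi> ` V0)"
    and S': "S' \<subseteq> S"
  shows "card {e \<in> F. e \<subseteq> S'} \<le> c * card S'"
proof -
  note pD = packingD[OF pack]
  define FS where "FS = {e \<in> F. e \<subseteq> S'}"
  have FSD: "e \<in> F" "e \<subseteq> S'" if "e \<in> FS" for e using that by (auto simp: FS_def)
  define V0 where "V0 = S' \<union> (\<Union>e\<in>FS. \<Union>u\<in>e. H e u)"
  \<comment> \<open>Distinct halves meet only in \<open>S\<close>. Outside \<open>S\<close> the end
    \<open>u\<close> is therefore unique, and the choice is well defined.\<close>
  define \<phi> where "\<phi> x = (if x \<in> S then x else (SOME u. \<exists>e\<in>F. u \<in> e \<and> x \<in> H e u))" for x
  have \<phi>_H: "\<phi> x = u" if "e \<in> F" "u \<in> e" "x \<in> H e u" for x u e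
  proof (cases "x \<in> S")
    case True
    then show ?thesis using pD(4)[OF that(1,2)] that by (auto simp: \<phi>_def)
  next
    case False
    have "(SOME u. \<exists>e\<in>F. u \<in> e \<and> x \<in> H e u) = u"
    proof (rule some_equality)
      fix w assume "\<exists>e\<in>F. w \<in> e \<and> x \<in> H e w"
      then obtain e' where "e' \<in> F" "w \<in> e'" "x \<in> H e' w" by blast
      then show "w = u" using pD(8)[OF that(1) _ that(2), of e' w x] that False by blast
    qed (use that in blast)
    then show ?thesis using False by (simp add: \<phi>_def)
  qed
  have \<phi>_S: "\<phi> x = x" if "x \<in> S'" for x using that S' by (auto simp: \<phi>_def)
  have im: "\<phi> ` V0 = S'"
  proof -
    have "\<phi> x \<in> S'" if "x \<in> V0" for x
    proof (cases "x \<in> S'")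
      case False
      then obtain e u where eu: "e \<in> FS" "u \<in> e" "x \<in> H e u" using \<open>x \<in> V0\<close> by (auto simp: V0_def)
      then show ?thesis using \<phi>_H[OF FSD(1)[OF eu(1)] eu(2,3)] FSD by blast
    qed (simp add: \<phi>_S)
    then show ?thesis using \<phi>_S by (force simp: V0_def)
  qed
  have "card FS \<le> c * card (\<phi> ` V0)"
  proof (rule c)
    show "V0 \<subseteq> vertices G" using S S' pD(3)[OF FSD(1)] unfolding V0_def by blast
    show "FS \<subseteq> {{\<phi> u, \<phi> v} | u v. u \<in> V0 \<and> v \<in> V0 \<and> {u, v} \<in> edges G \<and> \<phi> u \<noteq> \<phi> v}"
    proof
      fix e assume e: "e \<in> FS"
      then obtain u v where uv: "e = {u, v}" "u \<noteq> v" using pD(2)[OF FSD(1)[OF e]] by (metis card_2_iff)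
      then obtain x y where xy: "x \<in> H e u" "y \<in> H e v" "{x, y} \<in> edges G"
        using pD(7)[OF FSD(1)[OF e], of u v] by blast
      have "\<phi> x = u" "\<phi> y = v" using \<phi>_H[OF FSD(1)[OF e]] uv(1) xy by auto
      moreover have "x \<in> V0" "y \<in> V0" using xy e uv by (auto simp: V0_def)
      ultimately show "e \<in> {{\<phi> u, \<phi> v} | u v. u \<in> V0 \<and> v \<in> V0 \<and> {u, v} \<in> edges G \<and> \<phi> u \<noteq> \<phi> v}"
        using uv xy by blast
    qed
    fix h assume "h \<in> \<phi> ` V0"
    then have h: "h \<in> S'" using im by simp
    have "linked G {z \<in> V0. \<phi> z = h} n h y" if y: "y \<in> V0" "\<phi> y = h" for y
    proof (cases "y \<in> S'")
      case True
      then show ?thesis using y \<phi>_S by (auto intro: linked.refl)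
    next
      case False
      then obtain e u where eu: "e \<in> FS" "u \<in> e" "y \<in> H e u" using y by (auto simp: V0_def)
      have "u = h" using \<phi>_H[OF FSD(1)[OF eu(1)] eu(2,3)] y by simp
      have "H e u \<subseteq> {z \<in> V0. \<phi> z = h}"
        using eu \<phi>_H[OF FSD(1)[OF eu(1)] eu(2)] \<open>u = h\<close> by (auto simp: V0_def)
      with pD(6)[OF FSD(1)[OF eu(1)] eu(2,3)] show ?thesis
        unfolding \<open>u = h\<close> by (rule linked_mono[OF _ order_refl])
    qed
    then show "\<exists>x\<in>V0. \<phi> x = h \<and> (\<forall>y\<in>V0. \<phi> y = h \<longrightarrow> linked G {z \<in> V0. \<phi> z = h} n x y)"
      using h \<phi>_S by (intro bexI[of _ h]) (auto simp: V0_def)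
  qed
  then show ?thesis by (simp add: im FS_def)
qed

text \<open>A short walk from \<open>v\<close> into the ball \<open>T\<close> around
  \<open>u\<close> yields a further path. Its half at \<open>v\<close> stops just before
  \<open>T\<close> and its half at \<open>u\<close> runs inside \<open>T\<close>, so the halves are
  disjoint, and each meets \<open>B\<close> only in its end.\<close>

lemma packing_extend:
  assumes pack: "packing G n S F H"
    and B: "S \<subseteq> B" "\<And>e u. e \<in> F \<Longrightarrow> u \<in> e \<Longrightarrow> H e u \<subseteq> B"
    and uv: "u \<in> S" "v \<in> S" "u \<noteq> v" "{u, v} \<notin> F"
    and Tu: "T = {y. linked G (insert u (vertices G - B)) n u y}"
    and S: "S \<subseteq> vertices G"
    and link: "linked G (insert v (vertices G - B) \<union> T) (Suc n) v w" "w \<in> T"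
  shows "\<exists>H'. packing G n S (insert {u, v} F) H'"
proof -
  have TB: "T \<subseteq> insert u (vertices G - B)" using Tu linked_in(2) by fastforce
  then have "v \<notin> T" using uv B by auto
  \<comment> \<open>The edge into \<open>T\<close> uses one step of the bound \<open>Suc n\<close>,
    so \<open>n\<close> steps remain for the half at \<open>v\<close>.\<close>
  then obtain y z m where y: "m = n" "z \<in> T" "{y, z} \<in> edges G"
      "linked G (insert v (vertices G - B) \<union> T - T) m v y"
    using linked_before_hit[OF link(1) _ link(2)] by (metis Suc_inject)
  have "linked G (insert v (vertices G - B) \<union> T - T) n v y" using y by simp
  then obtain Hv where Hv: "Hv \<subseteq> insert v (vertices G - B) \<union> T - T" "card Hv \<le> Suc n" "v \<in> Hv"
    "y \<in> Hv" "\<And>x. x \<in> Hv \<Longrightarrow> linked G Hv n v x" by (rule linked_path) auto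
  have "linked G T n u z" using y(2) linked_ball[of G _ n u z] unfolding Tu by simp
  then obtain Hu where Hu: "Hu \<subseteq> T" "card Hu \<le> Suc n" "u \<in> Hu"
    "z \<in> Hu" "\<And>x. x \<in> Hu \<Longrightarrow> linked G Hu n u x" by (rule linked_path) auto
  have Hv': "Hv \<subseteq> insert v (vertices G - B)" "Hu \<inter> Hv = {}" using Hv(1) Hu(1) by auto
  have Hu': "Hu \<subseteq> insert u (vertices G - B)" using Hu(1) TB by auto
  note pD = packingD[OF pack]
  define H' where "H' = H({u, v} := (\<lambda>x. if x = u then Hu else Hv))"
  have new: "H' {u, v} u = Hu" "H' {u, v} v = Hv" using uv by (auto simp: H'_def)
  have old: "H' e = H e" if "e \<in> F" for e using that uv by (auto simp: H'_def)
  have VG: "Hu \<subseteq> vertices G" "Hv \<subseteq> vertices G" using Hu' Hv' uv S by auto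
  have IS: "Hu \<inter> S = {u}" "Hv \<inter> S = {v}" using Hu' Hv' Hu(3) Hv(3) uv B by auto
  have BS: "Hu \<inter> B \<subseteq> S" "Hv \<inter> B \<subseteq> S" using Hu' Hv' uv by auto
  have zy: "\<exists>x\<in>Hu. \<exists>y\<in>Hv. {x, y} \<in> edges G" "\<exists>x\<in>Hv. \<exists>y\<in>Hu. {x, y} \<in> edges G"
    using y(3) Hv(4) Hu(4) insert_commute[of y z "{}"] by metis+
  have "packing G n S (insert {u, v} F) H'"
    unfolding packing_def
  proof (intro conjI)
    show "\<forall>e\<in>insert {u, v} F. e \<subseteq> S \<and> card e = 2" using pD(1,2) uv by auto
    show "\<forall>e\<in>insert {u, v} F. \<forall>u\<in>e. H' e u \<subseteq> vertices G \<and> H' e u \<inter> S = {u} \<and>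
        card (H' e u) \<le> Suc n \<and> (\<forall>y\<in>H' e u. linked G (H' e u) n u y)"
      unfolding ball_simps using new old pD(3-6) VG IS Hu(2,5) Hv(2,5) by simp
    show "\<forall>e\<in>insert {u, v} F. \<forall>u\<in>e. \<forall>v\<in>e. u \<noteq> v \<longrightarrow>
        (\<exists>x\<in>H' e u. \<exists>y\<in>H' e v. {x, y} \<in> edges G)"
      unfolding ball_simps using new old pD(7) zy by simp
    have 1: "H' e x \<inter> Hu \<subseteq> S" "H' e x \<inter> Hv \<subseteq> S" if "e \<in> F" "x \<in> e" for e x
      using old[OF that(1)] B(2)[OF that] BS by auto
    have 2: "H' e x \<inter> H' e' x' \<subseteq> S" if "e \<in> F" "x \<in> e" "e' \<in> F" "x' \<in> e'" "(e, x) \<noteq> (e', x')" for e x e' x'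
      using old[OF that(1)] old[OF that(3)] pD(8)[OF that(1) that(3,2,4,5)] by auto
    show "\<forall>e\<in>insert {u, v} F. \<forall>e'\<in>insert {u, v} F. \<forall>u\<in>e. \<forall>u'\<in>e'.
        (e, u) \<noteq> (e', u') \<longrightarrow> H' e u \<inter> H' e' u' \<subseteq> S"
      unfolding ball_simps using new 1 2 Hv'(2) by (simp add: Int_commute)
  qed
  then show ?thesis by blast
qed

text \<open>If all vertices of \<open>S\<close> had fans with more than \<open>k\<close> tips, the
  balls around an independent set \<open>I\<close>, contracted to their centres, would send more
  than \<open>k * card I\<close> edges into a set \<open>B\<close> of size linear in
  \<open>card I\<close>, against the density of depth-\<open>n\<close> minors.\<close>

lemma fan_free_vertex:
  fixes C :: "'a graph set"
  assumes "\<And>G. G \<in> C \<Longrightarrow> simple_graph G" "bounded_expansion C"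
  obtains k :: nat where "\<And>G S. \<lbrakk>G \<in> C; S \<subseteq> vertices G; S \<noteq> {}\<rbrakk> \<Longrightarrow>
    \<exists>v\<in>S. \<forall>U P. fan G n S v U P \<longrightarrow> card U \<le> k"
proof -
  obtain c :: nat where c: "\<And>G V0 (\<phi> :: 'a \<Rightarrow> 'a) F. \<lbrakk>G \<in> C; V0 \<subseteq> vertices G;
      F \<subseteq> {{\<phi> u, \<phi> v} | u v. u \<in> V0 \<and> v \<in> V0 \<and> {u, v} \<in> edges G \<and> \<phi> u \<noteq> \<phi> v};
      \<And>h. h \<in> \<phi> ` V0 \<Longrightarrow>
        \<exists>x\<in>V0. \<phi> x = h \<and> (\<forall>y\<in>V0. \<phi> y = h \<longrightarrow> linked G {z \<in> V0. \<phi> z = h} n x y)\<rbrakk>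
    \<Longrightarrow> card F \<le> c * card (\<phi> ` V0)"
    by (rule bounded_expansion_minor_bound[OF assms, of n]) blast+
  \<comment> \<open>The factors bound the density of the minor, the ratio of \<open>card B\<close>
    to \<open>card S\<close>, and the ratio of \<open>card S\<close> to
    \<open>card I\<close>.\<close>
  define k where "k = c * (1 + c * (2 * n)) * (2 * c + 1)"
  show thesis
  proof (rule that[of k], rule ccontr)
    fix G S
    assume G: "G \<in> C" and S: "S \<subseteq> vertices G" "S \<noteq> {}"
      and stuck: "\<not> (\<exists>v\<in>S. \<forall>U P. fan G n S v U P \<longrightarrow> card U \<le> k)"
    note simple = assms(1)[OF G]
    have finV: "finite (vertices G)" using simple by (simp add: simple_graph_def)
    have finS: "finite S" using S finV finite_subset by blast
    have "\<forall>v\<in>S. \<exists>U. \<exists>P. fan G n S v U P \<and> k < card U" using stuck by (meson not_less)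
    then obtain U where "\<forall>v\<in>S. \<exists>P. fan G n S v (U v) P \<and> k < card (U v)" by metis
    then obtain P where fan: "\<And>v. v \<in> S \<Longrightarrow> fan G n S v (U v) (P v)" "\<And>v. v \<in> S \<Longrightarrow> k < card (U v)"
      by metis
    \<comment> \<open>The packed pairs form a subset of \<open>Pow S\<close>, so a packing with the
      most paths exists.\<close>
    have card_pack: "card F < Suc (card (Pow S))" if "\<exists>H. packing G n S F H" for F
      using that packingD(1) finS by (intro le_imp_less_Suc card_mono) blast+
    have "\<exists>H. packing G n S {} H" by (simp add: packing_def)
    then obtain F where F: "\<exists>H. packing G n S F H"
      and max: "\<And>F'. \<exists>H. packing G n S F' H \<Longrightarrow> card F' \<le> card F"
      using ex_has_greatest_nat[of "\<lambda>F. \<exists>H. packing G n S F H" "{}" card "Suc (card (Pow S))"] card_pack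
      by metis
    from F obtain H where pack: "packing G n S F H" by blast
    note pD = packingD[OF pack]
    have FS: "F \<subseteq> Pow S" using pD(1) by blast
    then have finF: "finite F" using finS finite_subset by blast
    have bound: "card {e \<in> F. e \<subseteq> S'} \<le> c * card S'" if "S' \<subseteq> S" for S'
      by (rule packing_minor_bound[OF S(1) pack c[OF G] that])
    have "{e \<in> F. e \<subseteq> S} = F" using FS by auto
    then have cardF: "card F \<le> c * card S" using bound[of S] by simp
    obtain I where I: "I \<subseteq> S" "\<forall>e\<in>F. \<not> e \<subseteq> I" "card S \<le> (2 * c + 1) * card I"
      using large_independent_set[OF finS pD(2) bound] by blast
    have finI: "finite I" using I finS finite_subset by blast
    \<comment> \<open>The space taken by the packing, together with \<open>S\<close>. The balls
      below avoid it except at their centres.\<close>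
    define B where "B = S \<union> (\<Union>e\<in>F. \<Union>u\<in>e. H e u)"
    have SB: "S \<subseteq> B" and HB: "\<And>e u. e \<in> F \<Longrightarrow> u \<in> e \<Longrightarrow> H e u \<subseteq> B" by (auto simp: B_def)
    have IB: "I \<subseteq> B" using I SB by blast
    have BV: "B \<subseteq> vertices G" using S pD(3) unfolding B_def by blast
    then have finB: "finite B" using finV finite_subset by blast
    \<comment> \<open>A half has at most \<open>n + 1\<close> vertices, one of them in
      \<open>S\<close>, so each path adds at most \<open>2 * n\<close> vertices to
      \<open>S\<close>.\<close>
    have cardB: "card B \<le> (1 + c * (2 * n)) * card S"
    proof -
      have half: "card (H e u - S) \<le> n" if "e \<in> F" "u \<in> e" for e u
      proof -
        have "card (H e u - S) < card (H e u)"
          using pD(4)[OF that] finite_subset[OF pD(3)[OF that] finV]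
          by (intro psubset_card_mono) auto
        then show ?thesis using pD(5)[OF that] by simp
      qed
      have both: "card (\<Union>u\<in>e. H e u - S) \<le> 2 * n" if "e \<in> F" for e
      proof -
        have "finite e" using pD(1)[OF that] finS finite_subset by blast
        then have "card (\<Union>u\<in>e. H e u - S) \<le> (\<Sum>u\<in>e. card (H e u - S))" by (rule card_UN_le)
        also have "\<dots> \<le> (\<Sum>u\<in>e. n)" using half that by (intro sum_mono)
        finally show ?thesis using pD(2)[OF that] by simp
      qed
      have B: "B = S \<union> (\<Union>e\<in>F. \<Union>u\<in>e. H e u - S)" by (auto simp: B_def)
      have "card B \<le> card S + card (\<Union>e\<in>F. \<Union>u\<in>e. H e u - S)" unfolding B by (rule card_Un_le)
      also have "\<dots> \<le> card S + (\<Sum>e\<in>F. card (\<Union>u\<in>e. H e u - S))"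
        using card_UN_le[OF finF] by (intro add_left_mono)
      also have "\<dots> \<le> card S + (\<Sum>e\<in>F. 2 * n)" using both by (intro add_left_mono sum_mono)
      also have "\<dots> = card S + card F * (2 * n)" by simp
      also have "\<dots> \<le> card S + c * card S * (2 * n)" using cardF by (intro add_left_mono mult_right_mono) auto
      also have "\<dots> = (1 + c * (2 * n)) * card S" by (simp add: algebra_simps)
      finally show ?thesis .
    qed
    define T where "T v = {y. linked G (insert v (vertices G - B)) n v y}" for v
    have T_sub: "T v \<subseteq> insert v (vertices G - B)" for v using linked_in(2) unfolding T_def by fastforce
    have T_self: "v \<in> T v" for v by (auto simp: T_def intro: linked.refl)
    \<comment> \<open>By maximality of \<open>F\<close>: such a walk would give one more path, and
      \<open>{u, v}\<close> is new because \<open>I\<close> is independent.\<close>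
    have nocross: False if "u \<in> I" "v \<in> I" "u \<noteq> v"
        "linked G (insert v (vertices G - B) \<union> T u) (Suc n) v w" "w \<in> T u" for u v w
    proof -
      have uv: "{u, v} \<notin> F" "u \<in> S" "v \<in> S" using I that by auto
      have "\<exists>H'. packing G n S (insert {u, v} F) H'"
        by (rule packing_extend[OF pack SB HB uv(2,3) that(3) uv(1) T_def S(1) that(4,5)])
      then have "card (insert {u, v} F) \<le> card F" by (rule max)
      then show False using uv finF by simp
    qed
    have T_disj: "T u \<inter> T v = {}" if "u \<in> I" "v \<in> I" "u \<noteq> v" for u v
    proof (rule ccontr)
      assume "T u \<inter> T v \<noteq> {}"
      then obtain x where x: "x \<in> T u" "x \<in> T v" by blast
      from x(2) have "linked G (insert v (vertices G - B) \<union> T u) (Suc n) v x"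
        unfolding T_def by (auto elim!: linked_mono)
      then show False using nocross[OF that] x(1) by blast
    qed
    define Nb where "Nb v = {t \<in> B. t \<noteq> v \<and> (\<exists>y\<in>T v. {y, t} \<in> edges G)}" for v
    \<comment> \<open>With \<open>Nb v\<close> disjoint from \<open>I\<close>, a pair
      \<open>{v, t}\<close> reveals which end is the centre, so the edges counted below are all
      different.\<close>
    have Nb_I: "Nb v \<inter> I = {}" if "v \<in> I" for v
    proof (rule ccontr)
      assume "Nb v \<inter> I \<noteq> {}"
      then obtain t y where t: "t \<in> I" "t \<noteq> v" "y \<in> T v" "{y, t} \<in> edges G" by (auto simp: Nb_def)
      have "linked G (insert v (vertices G - B) \<union> T t) n v y"
        using t(3) unfolding T_def by (auto elim!: linked_mono)
      then have "linked G (insert v (vertices G - B) \<union> T t) (Suc n) v t"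
        using t(4) T_self[of t] by (auto intro: linked_snoc)
      then show False using nocross[OF t(1) that t(2)] T_self by blast
    qed
    \<comment> \<open>Each walk of the fan first meets \<open>B - {v}\<close> in a vertex of its
      own, and the part before that vertex lies in the ball \<open>T v\<close>.\<close>
    have cardNb: "Suc k \<le> card (Nb v)" if v: "v \<in> I" for v
    proof -
      have vS: "v \<in> S" using I v by blast
      note f = fan(1)[OF vS, unfolded fan_def]
      have "\<exists>t. t \<in> P v u \<inter> Nb v" if u: "u \<in> U v" for u
      proof -
        have Pu: "P v u \<subseteq> vertices G" "P v u \<inter> S = {u}" "linked G (insert v (P v u)) n v u" "v \<noteq> u"
          using f u by auto
        then have "u \<in> B - {v}" using SB by auto
        then obtain y z m where y: "n = Suc m" "z \<in> B - {v}" "z \<in> insert v (P v u)" "{y, z} \<in> edges G"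
            "linked G (insert v (P v u) - (B - {v})) m v y"
          using linked_before_hit[OF Pu(3), of "B - {v}"] by blast
        have "linked G (insert v (vertices G - B)) n v y"
          using y(1) Pu(1) by (intro linked_mono[OF y(5)]) auto
        then show ?thesis using y by (auto simp: Nb_def T_def)
      qed
      then obtain t where t: "\<And>u. u \<in> U v \<Longrightarrow> t u \<in> P v u \<inter> Nb v" by metis
      have "inj_on t (U v)"
      proof (rule inj_onI, rule ccontr)
        fix x y assume "x \<in> U v" "y \<in> U v" "t x = t y" "x \<noteq> y"
        moreover have "P v x \<inter> P v y = {}" using f calculation by blast
        ultimately show False using t[of x] t[of y] by auto
      qed
      moreover have "t ` U v \<subseteq> Nb v" using t by blast
      moreover have "finite (Nb v)" using finB by (simp add: Nb_def)
      ultimately have "card (U v) \<le> card (Nb v)" by (rule card_inj_on_le)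
      then show ?thesis using fan(2)[OF vS] by simp
    qed
    define V0 where "V0 = B \<union> (\<Union>v\<in>I. T v)"
    \<comment> \<open>Each ball is contracted to its centre and \<open>B\<close> stays fixed;
      \<open>T_disj\<close> makes the centre unique.\<close>
    define \<phi> where "\<phi> x = (if x \<in> B then x else (SOME v. v \<in> I \<and> x \<in> T v))" for x
    have \<phi>_B: "\<phi> x = x" if "x \<in> B" for x using that by (simp add: \<phi>_def)
    have \<phi>_T: "\<phi> x = v" if "v \<in> I" "x \<in> T v" for x v
    proof (cases "x \<in> B")
      case True
      then show ?thesis using that T_sub \<phi>_B by blast
    next
      case False
      have "(SOME v. v \<in> I \<and> x \<in> T v) = v" using that T_disj by (intro some_equality) blast+
      then show ?thesis using False by (simp add: \<phi>_def)
    qed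
    have im: "\<phi> ` V0 \<subseteq> B"
    proof
      fix h assume "h \<in> \<phi> ` V0"
      then obtain x where x: "x \<in> V0" "h = \<phi> x" by blast
      show "h \<in> B"
      proof (cases "x \<in> B")
        case False
        then obtain v where "v \<in> I" "x \<in> T v" using x by (auto simp: V0_def)
        then show ?thesis using x \<phi>_T IB by auto
      qed (simp add: x \<phi>_B)
    qed
    let ?F = "(\<lambda>(v, t). {v, t}) ` (SIGMA v:I. Nb v)"
    have "card ?F \<le> c * card (\<phi> ` V0)"
    proof (rule c[OF G])
      show "V0 \<subseteq> vertices G" using BV T_sub IB unfolding V0_def by blast
      show "?F \<subseteq> {{\<phi> u, \<phi> v} | u v. u \<in> V0 \<and> v \<in> V0 \<and> {u, v} \<in> edges G \<and> \<phi> u \<noteq> \<phi> v}"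
      proof
        fix e assume "e \<in> ?F"
        then obtain v t where vt: "e = {v, t}" "v \<in> I" "t \<in> Nb v" by auto
        then obtain y where y: "y \<in> T v" "{y, t} \<in> edges G" "t \<in> B" "t \<noteq> v" by (auto simp: Nb_def)
        have "\<phi> y = v" "\<phi> t = t" using \<phi>_T[OF vt(2) y(1)] \<phi>_B[OF y(3)] by auto
        moreover have "y \<in> V0" "t \<in> V0" using vt y by (auto simp: V0_def)
        ultimately show "e \<in> {{\<phi> u, \<phi> v} | u v. u \<in> V0 \<and> v \<in> V0 \<and> {u, v} \<in> edges G \<and> \<phi> u \<noteq> \<phi> v}"
          using vt(1) y(2,4) by force
      qed
      fix h assume "h \<in> \<phi> ` V0"
      then have h: "h \<in> B" using im by blast
      have "linked G {z \<in> V0. \<phi> z = h} n h y" if y: "y \<in> V0" "\<phi> y = h" for y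
      proof (cases "y \<in> B")
        case True
        then show ?thesis using y \<phi>_B by (auto intro: linked.refl)
      next
        case False
        then obtain v where v: "v \<in> I" "y \<in> T v" using y by (auto simp: V0_def)
        then have [simp]: "v = h" using \<phi>_T y by auto
        have "linked G (T v) n v y" using v(2) linked_ball unfolding T_def by fastforce
        moreover have "T v \<subseteq> {z \<in> V0. \<phi> z = h}" using v \<phi>_T by (auto simp: V0_def)
        ultimately show ?thesis by (auto elim!: linked_mono)
      qed
      then show "\<exists>x\<in>V0. \<phi> x = h \<and> (\<forall>y\<in>V0. \<phi> y = h \<longrightarrow> linked G {z \<in> V0. \<phi> z = h} n x y)"
        using h \<phi>_B by (intro bexI[of _ h]) (auto simp: V0_def)
    qed
    also have "\<dots> \<le> c * card B" using im finB by (intro mult_left_mono card_mono) auto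
    also have "\<dots> \<le> c * ((1 + c * (2 * n)) * card S)" using cardB by (intro mult_left_mono) auto
    also have "\<dots> \<le> c * ((1 + c * (2 * n)) * ((2 * c + 1) * card I))"
      using I(3) by (intro mult_left_mono) auto
    also have "\<dots> = k * card I" by (simp only: k_def mult.assoc)
    finally have "card ?F \<le> k * card I" .
    moreover have "card ?F = (\<Sum>v\<in>I. card (Nb v))"
    proof -
      have "inj_on (\<lambda>(v, t). {v, t}) (SIGMA v:I. Nb v)"
        using Nb_I by (auto simp: inj_on_def doubleton_eq_iff)
      then have "card ?F = card (SIGMA v:I. Nb v)" by (rule card_image)
      also have "\<dots> = (\<Sum>v\<in>I. card (Nb v))" using finI finB by (intro card_SigmaI) (auto simp: Nb_def)
      finally show ?thesis .
    qed
    moreover have "(\<Sum>v\<in>I. Suc k) \<le> (\<Sum>v\<in>I. card (Nb v))" using cardNb by (intro sum_mono)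
    ultimately have "card I + k * card I \<le> k * card I" by (simp add: mult.commute)
    then have "card I = 0" by simp
    then show False using I(3) S finS by simp
  qed
qed

section \<open>Weak reachability\<close>

text \<open>The weakly \<open>n\<close>-reachable set known from generalised colouring numbers,
  where smaller labels come first in the order.\<close>

definition wreach :: "'a graph \<Rightarrow> ('a \<Rightarrow> nat) \<Rightarrow> nat \<Rightarrow> 'a \<Rightarrow> 'a set" where
  "wreach G L n v = {u. linked G {x \<in> vertices G. L u \<le> L x} n v u}"

lemma wreach_subset: "wreach G L n v \<subseteq> vertices G"
  using linked_in(2) by (fastforce simp: wreach_def)

lemma wreach_self: "v \<in> vertices G \<Longrightarrow> v \<in> wreach G L n v"
  by (auto simp: wreach_def intro: linked.refl)

text \<open>Labels are given from the largest down: a vertex without large fans in the present set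
  receives the top label and is removed. Hence the vertices with labels up to \<open>L v\<close>
  form the set from which \<open>v\<close> was removed.\<close>

lemma fan_order:
  assumes fin: "finite S" and S: "S \<subseteq> V"
    and free: "\<And>S. S \<subseteq> V \<Longrightarrow> S \<noteq> {} \<Longrightarrow> \<exists>v\<in>S. \<forall>U P. fan G n S v U P \<longrightarrow> card U \<le> k"
  shows "\<exists>L :: 'a \<Rightarrow> nat. inj_on L S \<and> (\<forall>v\<in>S. L v < card S) \<and>
    (\<forall>v\<in>S. \<forall>U P. fan G n {u \<in> S. L u \<le> L v} v U P \<longrightarrow> card U \<le> k)"
  using fin S
proof (induction "card S" arbitrary: S)
  case 0
  then show ?case by auto
next
  case (Suc m)
  then have "S \<noteq> {}" by auto
  then obtain v0 where v0: "v0 \<in> S" "\<forall>U P. fan G n S v0 U P \<longrightarrow> card U \<le> k"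
    using free[OF Suc.prems(2) \<open>S \<noteq> {}\<close>] by blast
  have m: "m = card (S - {v0})" using Suc v0 by simp
  have S': "finite (S - {v0})" "S - {v0} \<subseteq> V" using Suc.prems by auto
  obtain L :: "'a \<Rightarrow> nat" where L: "inj_on L (S - {v0})" "\<And>v. v \<in> S - {v0} \<Longrightarrow> L v < m"
    "\<And>v U P. v \<in> S - {v0} \<Longrightarrow> fan G n {u \<in> S - {v0}. L u \<le> L v} v U P \<Longrightarrow> card U \<le> k"
    using Suc.hyps(1)[OF m S'] unfolding m[symmetric] by blast
  let ?L = "L(v0 := m)"
  have "inj_on ?L S"
  proof (rule inj_onI)
    fix x y assume "x \<in> S" "y \<in> S" "?L x = ?L y"
    then show "x = y" using L(1) L(2)[of x] L(2)[of y]
      by (auto simp: inj_on_def split: if_splits)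
  qed
  moreover have "\<forall>v\<in>S. ?L v < card S" using L(2) Suc.hyps(2) by fastforce
  moreover have "card U \<le> k" if v: "v \<in> S" and f: "fan G n {u \<in> S. ?L u \<le> ?L v} v U P" for v U P
  proof (cases "v = v0")
    case True
    then have "{u \<in> S. ?L u \<le> ?L v} = S" using L(2) by fastforce
    then have "fan G n S v0 U P" using f True by simp
    then show ?thesis using v0(2) by blast
  next
    case False
    then have "{u \<in> S. ?L u \<le> ?L v} = {u \<in> S - {v0}. L u \<le> L v}" using L(2)[of v] v by auto
    then show ?thesis using L(3)[of v U P] f False v by simp
  qed
  ultimately show ?case by blast
qed

text \<open>A walk from \<open>x\<close> to a weakly reachable vertex enters the part of the order before \<open>x\<close>; until
  then it meets the tails of every maximal fan of \<open>x\<close>.\<close>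

lemma wreach_via_fan:
  assumes G: "simple_graph G" and L: "inj_on L (vertices G)" and x: "x \<in> vertices G"
    and k: "\<And>U P. fan G n {u \<in> vertices G. L u \<le> L x} x U P \<Longrightarrow> card U \<le> k"
    and j: "Suc j \<le> n"
  obtains M where "M \<subseteq> vertices G" "card M \<le> k * n"
    "wreach G L (Suc j) x \<subseteq> insert x (\<Union>z\<in>M. wreach G L j z)"
proof -
  let ?S = "{u \<in> vertices G. L u \<le> L x}"
  have finV: "finite (vertices G)" using G by (simp add: simple_graph_def)
  define Q where "Q U \<longleftrightarrow> (\<exists>P. fan G n ?S x U P)" for U
  have "card U < Suc k" if "Q U" for U using that k unfolding Q_def less_Suc_eq_le by blast
  moreover have "Q {}" by (simp add: fan_def Q_def)
  ultimately obtain U where "Q U" and max: "\<And>U'. Q U' \<Longrightarrow> card U' \<le> card U"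
    using ex_has_greatest_nat[of Q "{}" card "Suc k"] by metis
  then obtain P where P: "fan G n ?S x U P" unfolding Q_def by blast
  \<comment> \<open>The tails of a maximal fan: at most \<open>k\<close> of them, with at most
    \<open>n\<close> vertices each.\<close>
  define M where "M = (\<Union>u\<in>U. P u)"
  have "x \<notin> P u" if "u \<in> U" for u
  proof
    assume "x \<in> P u"
    then have "x \<in> P u \<inter> ?S" using x by simp
    then show False using P that unfolding fan_def by (metis singletonD)
  qed
  then have xM: "x \<notin> M" by (auto simp: M_def)
  have MV: "M \<subseteq> vertices G" using P by (auto simp: fan_def M_def)
  have "card M \<le> (\<Sum>u\<in>U. card (P u))" using P unfolding M_def by (intro card_UN_le) (simp add: fan_def)
  also have "\<dots> \<le> (\<Sum>u\<in>U. n)" using P by (intro sum_mono) (simp add: fan_def)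
  also have "\<dots> \<le> k * n" using k[OF P] by (simp add: mult_right_mono)
  finally have cardM: "card M \<le> k * n" .
  have "\<exists>z\<in>M. u \<in> wreach G L j z" if u: "u \<in> wreach G L (Suc j) x" "u \<noteq> x" for u
  proof -
    let ?D = "{y \<in> vertices G. L u \<le> L y}"
    have D: "linked G ?D (Suc j) x u" using u by (simp add: wreach_def)
    have "x \<in> ?D" "u \<in> ?D" using linked_in[OF D] by auto
    then have "L u < L x" using u L x by (auto simp: inj_on_def order.strict_iff_order)
    let ?Z = "{y. L y < L x}"
    \<comment> \<open>The target \<open>u\<close> itself lies in \<open>?Z\<close>, so the walk has
      a first vertex \<open>y\<close> that precedes \<open>x\<close> in the order.\<close>
    have "\<not> linked G (?D - ?Z) (Suc j) x u" using \<open>L u < L x\<close> linked_in(2)[of G "?D - ?Z" _ x u] by auto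
    then obtain y a b where y: "y \<in> ?Z" "a + b \<le> Suc j" "linked G (?D - ?Z \<union> {y}) a x y" "linked G ?D b y u"
      using linked_first_hit[OF D] by blast
    have yD: "y \<in> ?D" using linked_in(1)[OF y(4)] .
    \<comment> \<open>A walk to \<open>y\<close> that avoids \<open>M\<close> would enlarge the
      maximal fan by the tip \<open>y\<close>.\<close>
    have "\<not> linked G (?D - ?Z \<union> {y} - M) a x y"
    proof
      assume l: "linked G (?D - ?Z \<union> {y} - M) a x y"
      have "a \<le> n" using y j by simp
      obtain B where B: "B \<subseteq> ?D - ?Z \<union> {y} - M" "finite B" "card B \<le> Suc n" "linked G B n x y"
        "x \<in> B" "y \<in> B" by (rule linked_path[OF linked_mono[OF l \<open>a \<le> n\<close> order_refl]]) (rule that)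
      let ?P = "P(y := B - {x})"
      have yM: "y \<notin> M" using B by blast
      have "y \<in> ?S" "y \<noteq> x" using yD y by auto
      then have yU: "y \<notin> U" using P yM by (auto simp: fan_def M_def)
      have BS: "(B - {x}) \<inter> ?S = {y}"
      proof -
        have "w = y" if w: "w \<in> B" "w \<noteq> x" "w \<in> ?S" for w
        proof -
          have "L w \<noteq> L x" using w L x by (auto simp: inj_on_def)
          then show ?thesis using w B(1) by auto
        qed
        then show ?thesis using B(6) \<open>y \<in> ?S\<close> \<open>y \<noteq> x\<close> by blast
      qed
      have BI: "insert x (B - {x}) = B" using B by auto
      have old: "?P u = P u" if "u \<in> U" for u using that yU by auto
      have disj: "(B - {x}) \<inter> P u = {}" if "u \<in> U" for u using B(1) that by (auto simp: M_def)
      have Bc: "B - {x} \<subseteq> vertices G" "card (B - {x}) \<le> n" using B yD by auto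
      have "fan G n ?S x (insert y U) ?P"
        unfolding fan_def ball_simps
        using P[unfolded fan_def] yU \<open>y \<noteq> x\<close> BS BI old disj Bc B(4) by (auto simp: Int_commute)
      then have "card (insert y U) \<le> card U" using max unfolding Q_def by blast
      moreover have "finite U" using P by (simp add: fan_def)
      ultimately show False using yU by simp
    qed
    then obtain z a' b' where z: "z \<in> M" "a' + b' \<le> a" "linked G (?D - ?Z \<union> {y} - M \<union> {z}) a' x z"
      "linked G (?D - ?Z \<union> {y}) b' z y" using linked_first_hit[OF y(3)] by blast
    \<comment> \<open>Since \<open>x\<close> is outside \<open>M\<close>, at least one step precedes
      \<open>z\<close>; this brings the bound from \<open>Suc j\<close> down to
      \<open>j\<close>.\<close>
    have "a' \<noteq> 0"
    proof
      assume "a' = 0"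
      then have "linked G (?D - ?Z \<union> {y} - M \<union> {z}) 0 x z" using z by simp
      then have "x = z" by cases auto
      then show False using z xM by simp
    qed
    have "linked G ?D b' z y" using z(4) yD by (auto elim!: linked_mono)
    then have "linked G ?D (b' + b) z u" using y(4) by (rule linked_trans)
    then have "linked G ?D j z u" using \<open>a' \<noteq> 0\<close> z(2) y(2) by (auto elim!: linked_mono)
    then show ?thesis using z(1) by (auto simp: wreach_def)
  qed
  then have "wreach G L (Suc j) x \<subseteq> insert x (\<Union>z\<in>M. wreach G L j z)" by blast
  then show thesis using that MV cardM by blast
qed

text \<open>By \<open>wreach_via_fan\<close>, one more step costs the vertex itself and at most
  \<open>k * n\<close> weakly reachable sets of the previous length.\<close>

lemma card_wreach_le:
  assumes G: "simple_graph G" and L: "inj_on L (vertices G)"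
    and k: "\<And>x U P. x \<in> vertices G \<Longrightarrow> fan G n {u \<in> vertices G. L u \<le> L x} x U P \<Longrightarrow> card U \<le> k"
    and "j \<le> n" "x \<in> vertices G"
  shows "card (wreach G L j x) \<le> (k * n + 1) ^ j"
  using assms(4,5)
proof (induction j arbitrary: x)
  case 0
  have "wreach G L 0 x \<subseteq> {x}" by (auto simp: wreach_def elim: linked.cases)
  then show ?case using card_mono[of "{x}"] by simp
next
  case (Suc j)
  have finV: "finite (vertices G)" using G by (simp add: simple_graph_def)
  obtain M where M: "M \<subseteq> vertices G" "card M \<le> k * n"
    "wreach G L (Suc j) x \<subseteq> insert x (\<Union>z\<in>M. wreach G L j z)"
    by (rule wreach_via_fan[OF G L Suc.prems(2) k[OF Suc.prems(2)] Suc.prems(1)])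
  have finM: "finite M" using M finV finite_subset by blast
  have "finite (\<Union>z\<in>M. wreach G L j z)"
    using finM finite_subset[OF wreach_subset finV] by blast
  then have "card (wreach G L (Suc j) x) \<le> card (insert x (\<Union>z\<in>M. wreach G L j z))"
    using M(3) by (intro card_mono) auto
  also have "\<dots> \<le> Suc (card (\<Union>z\<in>M. wreach G L j z))" by (rule card_insert_le_m1) auto
  also have "\<dots> \<le> Suc (\<Sum>z\<in>M. card (wreach G L j z))" using card_UN_le[OF finM] by (intro Suc_le_mono[THEN iffD2])
  also have "\<dots> \<le> Suc (\<Sum>z\<in>M. (k * n + 1) ^ j)"
    using Suc.IH Suc.prems M(1) by (intro Suc_le_mono[THEN iffD2] sum_mono) auto
  also have "\<dots> \<le> Suc (k * n * (k * n + 1) ^ j)" using M(2) by (simp add: mult_right_mono)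
  \<comment> \<open>The summand 1 is absorbed by a power of a positive number, which closes the
    recursion.\<close>
  also have "\<dots> \<le> (k * n + 1) ^ j + k * n * (k * n + 1) ^ j" by (simp add: Suc_le_eq)
  also have "\<dots> = (k * n + 1) ^ Suc j" by simp
  finally show ?case .
qed

theorem bounded_expansion_wreach:
  fixes C :: "'a graph set"
  assumes "\<And>G. G \<in> C \<Longrightarrow> simple_graph G" "bounded_expansion C"
  obtains w :: nat where "\<And>G. G \<in> C \<Longrightarrow>
    \<exists>L :: 'a \<Rightarrow> nat. inj_on L (vertices G) \<and> (\<forall>v\<in>vertices G. card (wreach G L n v) \<le> w)"
proof -
  obtain k :: nat where k: "\<And>G S. \<lbrakk>G \<in> C; S \<subseteq> vertices G; S \<noteq> {}\<rbrakk> \<Longrightarrow>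
      \<exists>v\<in>S. \<forall>U P. fan G n S v U P \<longrightarrow> card U \<le> k"
    by (rule fan_free_vertex[OF assms, of n]) blast+
  show thesis
  proof (rule that[of "(k * n + 1) ^ n"])
    fix G assume G: "G \<in> C"
    have fin: "finite (vertices G)" using assms(1)[OF G] by (simp add: simple_graph_def)
    obtain L :: "'a \<Rightarrow> nat" where L: "inj_on L (vertices G)"
      "\<And>v U P. v \<in> vertices G \<Longrightarrow> fan G n {u \<in> vertices G. L u \<le> L v} v U P \<Longrightarrow> card U \<le> k"
      using fan_order[OF fin order_refl k[OF G]] by blast
    show "\<exists>L :: 'a \<Rightarrow> nat. inj_on L (vertices G) \<and>
        (\<forall>v\<in>vertices G. card (wreach G L n v) \<le> (k * n + 1) ^ n)"
    proof (intro exI[of _ L] conjI ballI L(1))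
      fix v assume "v \<in> vertices G"
      then show "card (wreach G L n v) \<le> (k * n + 1) ^ n"
        using L by (intro card_wreach_le[OF assms(1)[OF G]]) auto
    qed
  qed
qed

section \<open>Rank decompositions from binary laminar families\<close>

text \<open>The first and the last entry get one neighbour through the closing edge; distinctness
  and length at least 3 keep the two neighbours apart.\<close>

lemma cycle_neighbours:
  assumes "is_cycle G p" "x \<in> set p"
  shows "\<exists>y\<in>set p. \<exists>z\<in>set p. y \<noteq> z \<and> {x, y} \<in> edges G \<and> {x, z} \<in> edges G"
proof -
  obtain xs ys where p: "p = xs @ x # ys" using assms(2) by (meson split_list)
  have c: "walk G p" "distinct p" "3 \<le> length p" "{last p, hd p} \<in> edges G"
    using assms(1) by (auto simp: is_cycle_def)
  have succ: "{x, hd ys} \<in> edges G" if "ys \<noteq> []"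
    using c(1) that unfolding p walk_def successively_append_iff by (cases ys) auto
  have pred: "{x, last xs} \<in> edges G" if "xs \<noteq> []"
    using c(1) that unfolding p walk_def successively_append_iff by (auto simp: insert_commute)
  consider "xs \<noteq> []" "ys \<noteq> []" | "xs = []" | "ys = []" by blast
  then show ?thesis
  proof cases
    case 1
    have "last xs \<noteq> hd ys" using c(2) 1 unfolding p by (metis IntI distinct_append empty_iff
          hd_in_set last_in_set list.set_intros(2))
    then show ?thesis using 1 succ pred unfolding p
      by (intro bexI[of _ "last xs"] bexI[of _ "hd ys"]) auto
  next
    case 2
    then obtain a b zs where ys: "ys = a # b # zs" using c(3) p by (cases ys; cases "tl ys") auto
    have "{x, last ys} \<in> edges G" using c(4) unfolding p 2 ys by (simp add: insert_commute)
    moreover have "hd ys \<noteq> last ys" using c(2) unfolding p ys by auto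
    ultimately show ?thesis using succ unfolding p 2 ys
      by (intro bexI[of _ "last ys"] bexI[of _ "hd ys"]) (auto simp: ys)
  next
    case 3
    then obtain a b zs where xs: "xs = a # b # zs" using c(3) p by (cases xs; cases "tl xs") auto
    have "{x, hd xs} \<in> edges G" using c(4) unfolding p 3 xs by simp
    moreover have "hd xs \<noteq> last xs" using c(2) unfolding p xs by auto
    ultimately show ?thesis using pred unfolding p 3 xs
      by (intro bexI[of _ "last xs"] bexI[of _ "hd xs"]) (auto simp: xs)
  qed
qed

section \<open>Trees given by a parent function\<close>

locale parent_tree =
  fixes N :: "'b set" and \<rho> :: 'b and par :: "'b \<Rightarrow> 'b" and h :: "'b \<Rightarrow> nat"
  assumes fin: "finite N" and root: "\<rho> \<in> N"
    and par_in: "a \<in> N \<Longrightarrow> a \<noteq> \<rho> \<Longrightarrow> par a \<in> N"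
    and par_height: "a \<in> N \<Longrightarrow> a \<noteq> \<rho> \<Longrightarrow> h a < h (par a)"
begin

definition T :: "'b graph" where
  "T = Graph N {{a, par a} | a. a \<in> N - {\<rho>}}"

definition R :: "('b \<times> 'b) set" where
  "R = {(a, par a) | a. a \<in> N - {\<rho>}}"

definition desc :: "'b \<Rightarrow> 'b set" where
  "desc a = {x \<in> N. (x, a) \<in> R\<^sup>*}"

lemma vertices_T [simp]: "vertices T = N"
  by (simp add: T_def)

lemma edges_T: "edges T = {{a, par a} | a. a \<in> N - {\<rho>}}"
  by (simp add: T_def)

lemma edge_iff: "{x, y} \<in> edges T \<longleftrightarrow> (x, y) \<in> R \<or> (y, x) \<in> R"
  unfolding edges_T R_def by (auto simp: doubleton_eq_iff)

lemma R_D: "(x, y) \<in> R \<Longrightarrow> x \<in> N \<and> x \<noteq> \<rho> \<and> y \<in> N \<and> y = par x \<and> h x < h y"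
  using par_in par_height by (auto simp: R_def)

lemma simple_T: "simple_graph T"
proof -
  have "card {a, par a} = 2" if "a \<in> N" "a \<noteq> \<rho>" for a
    using par_height[OF that] by (cases "a = par a") auto
  then show ?thesis using fin par_in by (auto simp: simple_graph_def edges_T)
qed

text \<open>Heights grow along \<open>par\<close> and stay below the maximum over \<open>N\<close>,
  so climbing stops, and it can stop only at \<open>\<rho>\<close>.\<close>

lemma to_root: "a \<in> N \<Longrightarrow> (a, \<rho>) \<in> R\<^sup>*"
proof (induction "Max (h ` N) - h a" arbitrary: a rule: less_induct)
  case less
  show ?case
  proof (cases "a = \<rho>")
    case False
    have "h a < h (par a)" "par a \<in> N" using less False par_in par_height by auto
    moreover have "h (par a) \<le> Max (h ` N)" using fin calculation by simp
    ultimately have "(par a, \<rho>) \<in> R\<^sup>*" using less by auto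
    moreover have "(a, par a) \<in> R" using False less by (auto simp: R_def)
    ultimately show ?thesis by (rule converse_rtrancl_into_rtrancl[rotated])
  qed simp
qed

lemma desc_step: "(x, y) \<in> R \<Longrightarrow> y \<in> desc a \<Longrightarrow> x \<in> desc a"
  using R_D[of x y] by (simp add: desc_def converse_rtrancl_into_rtrancl)

text \<open>\<open>R\<close> is single-valued, so the chain from \<open>x\<close> to
  \<open>a\<close> must pass through the given parent \<open>y\<close>.\<close>

lemma desc_step_back:
  assumes "(x, y) \<in> R" "x \<in> desc a" "x \<noteq> a"
  shows "y \<in> desc a"
proof -
  obtain z where z: "(x, z) \<in> R" "(z, a) \<in> R\<^sup>*"
    using assms(2,3) by (auto simp: desc_def elim: converse_rtranclE)
  have "z = y" "y \<in> N" using R_D[OF assms(1)] R_D[OF z(1)] by auto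
  then show ?thesis using z(2) by (simp add: desc_def)
qed

text \<open>The graph \<open>G\<close> is arbitrary so that climbing gives walks both in
  \<open>T\<close> and in \<open>T\<close> without an edge.\<close>

lemma linked_up:
  assumes "(x, a) \<in> R\<^sup>*" "x \<in> A" "\<And>x y. (x, y) \<in> R \<Longrightarrow> x \<in> A \<Longrightarrow> x \<noteq> a \<Longrightarrow> y \<in> A \<and> {x, y} \<in> edges G"
  shows "\<exists>n. linked G A n x a"
  using assms(1,2)
proof (induction rule: converse_rtrancl_induct)
  case base
  then show ?case by (auto intro: linked.refl)
next
  case (step x y)
  show ?case
  proof (cases "x = a")
    case True
    then show ?thesis using step by (auto intro: linked.refl)
  next
    case False
    then show ?thesis using step assms(3)[OF step(1)] by (auto intro: linked.step)
  qed
qed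

lemma connected_T: "connected_graph T"
proof -
  have up: "\<exists>n. linked T N n x \<rho>" if "x \<in> N" for x
    using to_root[OF that] that by (rule linked_up) (simp_all add: edge_iff R_D)
  have "\<exists>n. linked T N n x y" if "x \<in> N" "y \<in> N" for x y
    using up[OF that(1)] up[OF that(2)] linked_trans linked_sym by metis
  then show ?thesis using root unfolding connected_graph_def walks_between_nonempty_iff by auto
qed

text \<open>Both neighbours of a lowest node of a cycle would be its parent.\<close>

lemma is_tree_T: "is_tree T"
proof -
  have "\<not> is_cycle T p" for p
  proof
    assume p: "is_cycle T p"
    then have "set p \<noteq> {}" by (auto simp: is_cycle_def walk_def)
    then obtain x where x: "x \<in> set p" "\<And>y. y \<in> set p \<Longrightarrow> h x \<le> h y"
      using ex_min_if_finite[of "h ` set p"] by (metis (no_types) finite_set arg_min_if_finite linorder_not_less)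
    obtain y z where "y \<in> set p" "z \<in> set p" "y \<noteq> z" "{x, y} \<in> edges T" "{x, z} \<in> edges T"
      using cycle_neighbours[OF p x(1)] by blast
    then have "y = par x" "z = par x" using x(2)[of y] x(2)[of z] R_D[of x y] R_D[of y x] R_D[of x z] R_D[of z x]
      unfolding edge_iff by auto
    then show False using \<open>y \<noteq> z\<close> by simp
  qed
  then show ?thesis using simple_T connected_T by (simp add: is_tree_def)
qed

lemma degree_T:
  assumes "t \<in> N"
  shows "degree T t = (if t = \<rho> then 0 else 1) + card {a \<in> N - {\<rho>}. par a = t}"
proof -
  let ?C = "{a \<in> N - {\<rho>}. par a = t}"
  let ?P = "if t = \<rho> then {} else {{t, par t}}"
  have neq: "par a \<noteq> a" if "a \<in> N - {\<rho>}" for a using par_height[of a] that by auto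
  have "{e \<in> edges T. t \<in> e} = ?P \<union> (\<lambda>a. {a, t}) ` ?C"
    using assms by (auto simp: edges_T insert_commute)
  \<comment> \<open>A child of \<open>t\<close> that is also its parent would be both lower and
    higher than \<open>t\<close>.\<close>
  moreover have "?P \<inter> (\<lambda>a. {a, t}) ` ?C = {}"
    using par_height[of t] par_height[of "par t"] assms by (auto simp: doubleton_eq_iff)
  moreover have "inj_on (\<lambda>a. {a, t}) ?C" by (auto simp: inj_on_def doubleton_eq_iff)
  moreover have "finite ?C" using fin by simp
  ultimately show ?thesis unfolding degree_def by (simp add: card_Un_disjoint card_image)
qed

text \<open>Nodes of \<open>desc a\<close> still climb to \<open>a\<close>, all others climb to
  \<open>\<rho>\<close> outside \<open>desc a\<close>, and no remaining edge leaves
  \<open>desc a\<close>.\<close>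

lemma components_delete_edge:
  assumes a: "a \<in> N" "a \<noteq> \<rho>"
  shows "components (delete_edge T {a, par a}) \<subseteq> {desc a, N - desc a}"
proof
  let ?T = "delete_edge T {a, par a}"
  have V: "vertices ?T = N" by (simp add: delete_edge_def)
  have edge: "{x, y} \<in> edges ?T" if "(x, y) \<in> R" "x \<noteq> a" for x y
  proof -
    have "{x, y} \<noteq> {a, par a}" using that R_D[of x y] par_height[OF a] by (auto simp: doubleton_eq_iff)
    then show ?thesis using that by (simp add: delete_edge_def edge_iff)
  qed
  have down: "\<exists>n. linked ?T N n x a" if "x \<in> desc a" for x
  proof -
    have "\<exists>n. linked ?T (desc a) n x a"
      using that desc_step_back edge by (intro linked_up) (auto simp: desc_def)
    then show ?thesis by (auto simp: desc_def elim!: linked_mono)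
  qed
  have up: "\<exists>n. linked ?T N n x \<rho>" if "x \<in> N - desc a" for x
  proof -
    have "a \<in> desc a" using a by (simp add: desc_def)
    then have "{x, y} \<in> edges ?T" if "(x, y) \<in> R" "x \<notin> desc a" for x y
      using edge[OF that(1)] that(2) by blast
    then have "\<exists>n. linked ?T (N - desc a) n x \<rho>"
      using that desc_step to_root R_D by (intro linked_up) blast+
    then show ?thesis by (auto elim!: linked_mono)
  qed
  have cross: "x \<in> desc a \<longleftrightarrow> y \<in> desc a" if "linked ?T N n x y" for n x y
    using that
  proof (induction)
    case (step u w n v)
    have *: "{u, w} \<noteq> {a, par a}" "(u, w) \<in> R \<or> (w, u) \<in> R"
      using step(1) by (auto simp: delete_edge_def edge_iff)
    have "u \<noteq> a" if "(u, w) \<in> R" using *(1) R_D[OF that] by auto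
    moreover have "w \<noteq> a" if "(w, u) \<in> R" using *(1) R_D[OF that] by auto
    ultimately have "u \<in> desc a \<longleftrightarrow> w \<in> desc a"
      using *(2) desc_step[of u w a] desc_step[of w u a] desc_step_back[of u w a] desc_step_back[of w u a]
      by blast
    then show ?case using step by simp
  qed simp
  fix K assume "K \<in> components ?T"
  then obtain u where u: "u \<in> N" "K = {v \<in> N. \<exists>n. linked ?T N n u v}"
    unfolding components_def walks_between_nonempty_iff V by blast
  show "K \<in> {desc a, N - desc a}"
  proof (cases "u \<in> desc a")
    case True
    have "\<exists>n. linked ?T N n u v" if "v \<in> desc a" for v
      using down[OF True] down[OF that] linked_trans linked_sym by metis
    moreover have "desc a \<subseteq> N" by (auto simp: desc_def)
    ultimately have "K = desc a" using u True cross by blast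
    then show ?thesis by simp
  next
    case False
    have "\<exists>n. linked ?T N n u v" if "v \<in> N - desc a" for v
      using up[of u] up[OF that] False u(1) linked_trans linked_sym by (metis DiffI)
    then have "K = N - desc a" using u False cross by blast
    then show ?thesis by simp
  qed
qed

end

section \<open>Binary trees as laminar families\<close>

text \<open>Encodes a rooted binary tree with leaf set \<open>D\<close>: each node is named by the
  set of leaves below it, so that inclusion is the tree order.\<close>

inductive binary_family :: "'a set set \<Rightarrow> 'a set \<Rightarrow> bool" where
  single: "binary_family {{x}} {x}"
| join: "binary_family B1 D1 \<Longrightarrow> binary_family B2 D2 \<Longrightarrow> D1 \<inter> D2 = {} \<Longrightarrow>
    binary_family (insert (D1 \<union> D2) (B1 \<union> B2)) (D1 \<union> D2)"

lemma binary_familyD: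
  assumes "binary_family B D"
  shows "finite B" "D \<in> B" "finite D" "\<And>A. A \<in> B \<Longrightarrow> A \<noteq> {} \<and> A \<subseteq> D" "\<And>x. x \<in> D \<Longrightarrow> {x} \<in> B"
  using assms by induction auto

text \<open>The parent of a member is the least member strictly above it. A join keeps the parents
  of both families and puts the two old roots under the new one; disjointness of \<open>D1\<close>
  and \<open>D2\<close> keeps the families from interfering.\<close>

lemma binary_family_parent:
  assumes "binary_family B D"
  shows "\<exists>par. (\<forall>A\<in>B - {D}. par A \<in> B \<and> A \<subset> par A \<and> (\<forall>A'\<in>B. A \<subset> A' \<longrightarrow> par A \<subseteq> A')) \<and>
    (\<forall>A\<in>B. card {A' \<in> B - {D}. par A' = A} = (if \<exists>x. A = {x} then 0 else 2))"
  using assms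
proof (induction)
  case (single x)
  then show ?case by auto
next
  case (join B1 D1 B2 D2)
  note d1 = binary_familyD[OF join(1)] and d2 = binary_familyD[OF join(2)]
  obtain p1 where p1_all: "\<forall>A\<in>B1 - {D1}. p1 A \<in> B1 \<and> A \<subset> p1 A \<and> (\<forall>A'\<in>B1. A \<subset> A' \<longrightarrow> p1 A \<subseteq> A')"
      "\<forall>A\<in>B1. card {A' \<in> B1 - {D1}. p1 A' = A} = (if \<exists>x. A = {x} then 0 else 2)"
    using join.IH(1) by (elim exE conjE)
  note p1 = bspec[OF p1_all(1)] bspec[OF p1_all(2)]
  obtain p2 where p2_all: "\<forall>A\<in>B2 - {D2}. p2 A \<in> B2 \<and> A \<subset> p2 A \<and> (\<forall>A'\<in>B2. A \<subset> A' \<longrightarrow> p2 A \<subseteq> A')"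
      "\<forall>A\<in>B2. card {A' \<in> B2 - {D2}. p2 A' = A} = (if \<exists>x. A = {x} then 0 else 2)"
    using join.IH(2) by (elim exE conjE)
  note p2 = bspec[OF p2_all(1)] bspec[OF p2_all(2)]
  let ?D = "D1 \<union> D2" and ?B = "insert (D1 \<union> D2) (B1 \<union> B2)"
  have ne: "D1 \<noteq> {}" "D2 \<noteq> {}" using d1 d2 by auto
  have dis: "A \<inter> A' = {}" "\<not> A \<subseteq> A'" "\<not> A' \<subseteq> A" if "A \<in> B1" "A' \<in> B2" for A A'
    using d1(4)[OF that(1)] d2(4)[OF that(2)] join(3) by auto
  have D: "?D \<notin> B1" "?D \<notin> B2" "D1 \<noteq> D2" using d1(4)[of ?D] d2(4)[of ?D] ne join(3) by auto
  define p where "p A = (if A = D1 \<or> A = D2 then ?D else if A \<in> B1 then p1 A else p2 A)" for A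
  have pD: "p D1 = ?D" "p D2 = ?D" by (auto simp: p_def)
  have pB1: "p A = p1 A" "p A \<in> B1" if "A \<in> B1 - {D1}" for A
    using that dis(2)[of A D2] d2(2) p1(1)[OF that] unfolding p_def by auto
  have pB2: "p A = p2 A" "p A \<in> B2" if "A \<in> B2 - {D2}" for A
    using that dis(2)[of D1 A] dis(2)[of A A] d1(2) p2(1)[OF that] by (auto simp: p_def)
  have "p A \<in> ?B \<and> A \<subset> p A \<and> (\<forall>A'\<in>?B. A \<subset> A' \<longrightarrow> p A \<subseteq> A')" if A: "A \<in> ?B - {?D}" for A
  proof -
    consider "A = D1" | "A = D2" | "A \<in> B1 - {D1}" | "A \<in> B2 - {D2}" using A by blast
    then show ?thesis
    proof cases
      case 1
      have "A' = ?D" if "A' \<in> ?B" "D1 \<subset> A'" for A'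
        using that d1(4)[of A'] dis(2)[OF d1(2), of A'] by blast
      moreover have "D1 \<subset> ?D" using ne join(3) by blast
      ultimately show ?thesis using 1 pD by auto
    next
      case 2
      have "A' = ?D" if "A' \<in> ?B" "D2 \<subset> A'" for A'
        using that d2(4)[of A'] dis(3)[OF _ d2(2), of A'] by blast
      moreover have "D2 \<subset> ?D" using ne join(3) by blast
      ultimately show ?thesis using 2 pD by auto
    next
      case 3
      then have "p1 A \<subseteq> D1" using p1(1) d1(4) by auto
      then show ?thesis using 3 pB1[OF 3] p1(1)[OF 3] dis(2)[of A] by auto
    next
      case 4
      then have "p2 A \<subseteq> D2" using p2(1) d2(4) by auto
      then show ?thesis using 4 pB2[OF 4] p2(1)[OF 4] dis(3)[of _ A] by auto
    qed
  qed
  moreover have "card {A' \<in> ?B - {?D}. p A' = A} = (if \<exists>x. A = {x} then 0 else 2)" if A: "A \<in> ?B" for A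
  proof -
    have split: "?B - {?D} = {D1, D2} \<union> (B1 - {D1}) \<union> (B2 - {D2})" using d1(2) d2(2) D by auto
    consider "A = ?D" | "A \<in> B1" | "A \<in> B2" using A by blast
    then show ?thesis
    proof cases
      case 1
      have "A' \<in> {D1, D2}" if "A' \<in> ?B - {?D}" "p A' = A" for A'
      proof (rule ccontr)
        assume "A' \<notin> {D1, D2}"
        then have "A' \<in> B1 - {D1} \<or> A' \<in> B2 - {D2}" using that(1) by auto
        then have "p A' \<in> B1 \<union> B2" using pB1(2)[of A'] pB2(2)[of A'] by auto
        then show False using that(2) 1 D(1,2) by auto
      qed
      moreover have "D1 \<in> ?B - {?D}" "D2 \<in> ?B - {?D}" unfolding split by auto
      ultimately have "{A' \<in> ?B - {?D}. p A' = A} = {D1, D2}"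
        using 1 pD by (intro set_eqI) auto
      moreover have "\<nexists>x. A = {x}" using 1 ne join(3) by (auto simp: Un_singleton_iff)
      ultimately show ?thesis using D(3) by simp
    next
      case 2
      have "{A' \<in> ?B - {?D}. p A' = A} = {A' \<in> B1 - {D1}. p1 A' = A}"
      proof (intro set_eqI iffI)
        fix A' assume "A' \<in> {A' \<in> ?B - {?D}. p A' = A}"
        then have A': "A' \<in> {D1, D2} \<union> (B1 - {D1}) \<union> (B2 - {D2})" "p A' = A" unfolding split by auto
        have "A' \<noteq> D1" "A' \<noteq> D2" using A'(2) pD D(1) 2 by auto
        moreover have "A' \<notin> B2 - {D2}" using pB2(2)[of A'] A'(2) 2 dis(2)[of A A] by auto
        ultimately show "A' \<in> {A' \<in> B1 - {D1}. p1 A' = A}" using A' pB1(1)[of A'] by auto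
      qed (use pB1(1) split in auto)
      then show ?thesis using p1(2)[OF 2] by simp
    next
      case 3
      have "{A' \<in> ?B - {?D}. p A' = A} = {A' \<in> B2 - {D2}. p2 A' = A}"
      proof (intro set_eqI iffI)
        fix A' assume "A' \<in> {A' \<in> ?B - {?D}. p A' = A}"
        then have A': "A' \<in> {D1, D2} \<union> (B1 - {D1}) \<union> (B2 - {D2})" "p A' = A" unfolding split by auto
        have "A' \<noteq> D1" "A' \<noteq> D2" using A'(2) pD D(2) 3 by auto
        moreover have "A' \<notin> B1 - {D1}" using pB1(2)[of A'] A'(2) 3 dis(2)[of A A] by auto
        ultimately show "A' \<in> {A' \<in> B2 - {D2}. p2 A' = A}" using A' pB2(1)[of A'] by auto
      qed (use pB2(1) split in auto)
      then show ?thesis using p2(2)[OF 3] by simp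
    qed
  qed
  ultimately show ?case by (intro exI[of _ p]) simp
qed

text \<open>\<open>x0\<close> becomes an extra leaf attached to the node \<open>D\<close> and serves
  as root of the tree. This supplies the edge missing at \<open>D\<close>, and every edge then cuts
  the vertices into a member of \<open>B\<close> and its complement.\<close>

lemma binary_family_rank_width:
  fixes H :: "'a graph"
  assumes fin: "finite (vertices H)" and x0: "x0 \<in> vertices H"
    and fam: "binary_family B (vertices H - {x0})"
    and k: "\<And>A. A \<in> B \<Longrightarrow> cutrk H A \<le> k \<and> cutrk H (vertices H - A) \<le> k"
  shows "rank_width H \<le> k"
proof -
  let ?X = "vertices H"
  define D where "D = ?X - {x0}"
  note fam' = fam[folded D_def]
  note bf = binary_familyD[OF fam']
  obtain p where p_all: "\<forall>A\<in>B - {D}. p A \<in> B \<and> A \<subset> p A \<and> (\<forall>A'\<in>B. A \<subset> A' \<longrightarrow> p A \<subseteq> A')"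
      "\<forall>A\<in>B. card {A' \<in> B - {D}. p A' = A} = (if \<exists>x. A = {x} then 0 else 2)"
    using binary_family_parent[OF fam'] by (elim exE conjE)
  have p: "p A \<in> B \<and> A \<subset> p A \<and> (\<forall>A'\<in>B. A \<subset> A' \<longrightarrow> p A \<subseteq> A')" if "A \<in> B" "A \<noteq> D" for A
    using p_all(1) that by simp
  note p_card = bspec[OF p_all(2)]
  have x0B: "{x0} \<notin> B" using bf(4)[of "{x0}"] by (auto simp: D_def)
  define \<N> where "\<N> = insert {x0} B"
  have "finite \<N>" using bf(1) by (simp add: \<N>_def)
  \<comment> \<open>A rank decomposition has natural numbers as tree nodes, so the sets are numbered
    by \<open>f\<close> and decoded by \<open>g\<close>.\<close>
  then obtain f :: "'a set \<Rightarrow> nat" where f: "inj_on f \<N>" using finite_imp_inj_to_nat_seg by metis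
  define g where "g = inv_into \<N> f"
  have gf: "g (f A) = A" if "A \<in> \<N>" for A using f that by (simp add: g_def)
  have f_eq: "f A = f A' \<longleftrightarrow> A = A'" if "A \<in> \<N>" "A' \<in> \<N>" for A A' using f that by (auto simp: inj_on_def)
  have BN: "A \<in> \<N>" if "A \<in> B" for A using that by (simp add: \<N>_def)
  have xN: "{x0} \<in> \<N>" by (simp add: \<N>_def)
  define par where "par n = f (if g n = D then {x0} else p (g n))" for n
  \<comment> \<open>The root needs its own value because \<open>{x0}\<close> is the parent of
    \<open>D\<close> without containing it.\<close>
  define ht where "ht n = (if g n = {x0} then Suc (card D) else card (g n))" for n
  let ?N = "f ` \<N>" and ?\<rho> = "f {x0}"
  have par_f: "par (f A) = f (if A = D then {x0} else p A)" if "A \<in> B" for A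
    using that gf BN by (simp add: par_def)
  have N_cases: "\<exists>A\<in>B. n = f A" if "n \<in> ?N" "n \<noteq> ?\<rho>" for n using that by (auto simp: \<N>_def)
  have neq_root: "f A \<noteq> ?\<rho>" if "A \<in> B" for A using f_eq[OF BN[OF that] xN] that x0B by auto
  have card_le: "card A \<le> card D" if "A \<in> B" for A using bf(3,4) that by (simp add: card_mono)
  interpret parent_tree ?N ?\<rho> par ht
  proof
    show "finite ?N" using \<open>finite \<N>\<close> by simp
    show "?\<rho> \<in> ?N" using xN by simp
  next
    fix a assume a: "a \<in> ?N" "a \<noteq> ?\<rho>"
    then obtain A where A: "A \<in> B" "a = f A" using N_cases by blast
    show "par a \<in> ?N" using A p by (auto simp: par_f \<N>_def)
    show "ht a < ht (par a)"
    proof (cases "A = D")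
      case True
      then show ?thesis using A par_f gf[OF xN] gf[OF BN[OF A(1)]] x0B by (auto simp: ht_def)
    next
      case False
      then have pA: "p A \<in> B" "A \<subset> p A" using p A by auto
      have "finite (p A)" using bf(4)[OF pA(1)] bf(3) finite_subset by blast
      then have "card A < card (p A)" using pA(2) by (rule psubset_card_mono)
      then show ?thesis using A False par_f gf[OF BN[OF pA(1)]] gf[OF BN[OF A(1)]] x0B pA by (auto simp: ht_def)
    qed
  qed
  have deg_B: "degree T (f A) = (if \<exists>x. A = {x} then 1 else 3)" if A: "A \<in> B" for A
  proof -
    have "{a \<in> ?N - {?\<rho>}. par a = f A} = f ` {A' \<in> B - {D}. p A' = A}"
    proof (intro set_eqI iffI)
      fix a assume a: "a \<in> {a \<in> ?N - {?\<rho>}. par a = f A}"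
      then obtain A' where "A' \<in> B" "a = f A'" using N_cases[of a] by auto
      then have A': "A' \<in> B" "a = f A'" "par (f A') = f A" using a by auto
      show "a \<in> f ` {A' \<in> B - {D}. p A' = A}"
      proof (cases "A' = D")
        case True
        then show ?thesis using A' par_f neq_root[OF A] by auto
      next
        case False
        then have "p A' = A" using A' par_f f_eq[of "p A'" A] p[of A'] BN A by auto
        then show ?thesis using A' False by auto
      qed
    next
      fix a assume "a \<in> f ` {A' \<in> B - {D}. p A' = A}"
      then show "a \<in> {a \<in> ?N - {?\<rho>}. par a = f A}" using par_f neq_root BN by auto
    qed
    moreover have "inj_on f {A' \<in> B - {D}. p A' = A}" using f by (rule inj_on_subset) (auto simp: \<N>_def)
    ultimately show ?thesis
      using p_card[OF A] neq_root[OF A] degree_T[of "f A"] BN[OF A] by (simp add: card_image)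
  qed
  have deg_root: "degree T ?\<rho> = 1"
  proof -
    have "{a \<in> ?N - {?\<rho>}. par a = ?\<rho>} = {f D}"
    proof (intro set_eqI iffI)
      fix a assume a: "a \<in> {a \<in> ?N - {?\<rho>}. par a = ?\<rho>}"
      then obtain A' where "A' \<in> B" "a = f A'" using N_cases[of a] by auto
      then have "A' \<in> B" "a = f A'" "par (f A') = ?\<rho>" using a by auto
      then show "a \<in> {f D}" using par_f p[of A'] neq_root by (cases "A' = D") auto
    next
      fix a assume "a \<in> {f D}"
      then show "a \<in> {a \<in> ?N - {?\<rho>}. par a = ?\<rho>}" using par_f neq_root BN bf(2) by auto
    qed
    then show ?thesis using degree_T[of ?\<rho>] xN by simp
  qed
  define L where "L x = f {x}" for x
  have single: "{x} \<in> \<N>" if "x \<in> ?X" for x using that bf(5)[of x] by (auto simp: \<N>_def D_def)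
  have rd: "rank_decomposition H T L"
    unfolding rank_decomposition_def
  proof (intro conjI ballI is_tree_T)
    have "{?\<rho>, f D} \<subseteq> ?N" using xN BN bf(2) by auto
    then have "card {?\<rho>, f D} \<le> card ?N" using fin by (intro card_mono) auto
    then show "card (vertices T) \<ge> 2" using neq_root[OF bf(2)] by simp
    show "degree T t \<in> {1, 3}" if t: "t \<in> vertices T" for t
    proof (cases "t = ?\<rho>")
      case False
      then obtain A where "A \<in> B" "t = f A" using N_cases[of t] t by auto
      then show ?thesis using deg_B by simp
    qed (simp add: deg_root)
    have "inj_on L ?X" using single f_eq by (auto simp: inj_on_def L_def)
    moreover have "L ` ?X = leaves T"
    proof (intro set_eqI iffI)
      fix t assume "t \<in> L ` ?X"
      then obtain x where x: "x \<in> ?X" "t = f {x}" by (auto simp: L_def)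
      have "degree T t = 1"
      proof (cases "x = x0")
        case False
        then show ?thesis using x deg_B bf(5)[of x] by (simp add: D_def)
      qed (use x deg_root in simp)
      then show "t \<in> leaves T" using x single[OF x(1)] by (simp add: leaves_def)
    next
      fix t assume t: "t \<in> leaves T"
      show "t \<in> L ` ?X"
      proof (cases "t = ?\<rho>")
        case True
        then show ?thesis using x0 by (auto simp: L_def)
      next
        case False
        then obtain A where A: "A \<in> B" "t = f A" using N_cases[of t] t by (auto simp: leaves_def)
        then obtain x where "A = {x}" using deg_B t by (auto simp: leaves_def split: if_splits)
        then show ?thesis using A bf(4) by (auto simp: L_def D_def)
      qed
    qed
    ultimately show "bij_betw L ?X (leaves T)" by (simp add: bij_betw_def)
  qed
  have "decomposition_width H T L \<le> k"
  proof -
    let ?W = "{cutrk H {v \<in> ?X. L v \<in> K} | e K. e \<in> edges T \<and> K \<in> components (delete_edge T e)}"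
    \<comment> \<open>Climbing enlarges the decoded set, so descendants of \<open>f A\<close> decode
      to subsets of \<open>A\<close>. Conversely, \<open>p\<close> picks least members, so a chain
      that starts below \<open>A\<close> cannot bypass it.\<close>
    have desc_f: "{v \<in> ?X. L v \<in> desc (f A)} = A" if A: "A \<in> B" for A
    proof -
      have 1: "g x \<subseteq> A" if "(x, f A) \<in> R\<^sup>*" "x \<in> ?N" for x
        using that
      proof (induction rule: converse_rtrancl_induct)
        case base
        then show ?case using gf BN A by simp
      next
        case (step x y)
        then have y: "y \<in> ?N" "x \<in> ?N" "x \<noteq> ?\<rho>" "y = par x" using R_D by auto
        then obtain A' where A': "A' \<in> B" "x = f A'" using N_cases[of x] by auto
        have gy: "g y \<subseteq> A" using step y by simp
        show ?case
        proof (cases "A' = D")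
          case True
          then have "g y = {x0}" using y A' par_f gf xN by simp
          then show ?thesis using gy bf(4)[OF A] by (auto simp: D_def)
        next
          case False
          then have "g y = p A'" using y A' par_f gf BN p by simp
          then show ?thesis using gy p[of A'] A' False gf BN by auto
        qed
      qed
      have 2: "(f A', f A) \<in> R\<^sup>*" if "A' \<in> B" "A' \<subseteq> A" for A'
        using that
      proof (induction "card A - card A'" arbitrary: A' rule: less_induct)
        case less
        show ?case
        proof (cases "A' = A")
          case False
          then have sub: "A' \<subset> A" using less.prems by blast
          then have "A' \<noteq> D" using bf(4)[OF A] by blast
          then have pA: "p A' \<in> B" "A' \<subset> p A'" "p A' \<subseteq> A" using p[OF less.prems(1)] sub A by auto
          have "finite A" using bf(3,4) A finite_subset by blast
          then have "card A' < card (p A')" "card (p A') \<le> card A"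
            using pA by (auto intro!: psubset_card_mono card_mono intro: finite_subset)
          then have "(f (p A'), f A) \<in> R\<^sup>*" using less.hyps pA by auto
          moreover have "(f A', f (p A')) \<in> R"
            using \<open>A' \<noteq> D\<close> par_f[OF less.prems(1)] neq_root[OF less.prems(1)] BN[OF less.prems(1)]
            by (auto simp: R_def)
          ultimately show ?thesis by (rule converse_rtrancl_into_rtrancl[rotated])
        qed simp
      qed
      show ?thesis
      proof (intro set_eqI iffI)
        fix v assume "v \<in> {v \<in> ?X. L v \<in> desc (f A)}"
        then have "g (f {v}) \<subseteq> A" "v \<in> ?X" using 1 by (auto simp: desc_def L_def)
        then show "v \<in> A" using gf single by simp
      next
        fix v assume v: "v \<in> A"
        then have "v \<in> D" using bf(4)[OF A] by blast
        then show "v \<in> {v \<in> ?X. L v \<in> desc (f A)}"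
          using v 2[of "{v}"] bf(5) BN by (auto simp: desc_def L_def D_def)
      qed
    qed
    have W: "w \<le> k" if w: "w \<in> ?W" for w
    proof -
      obtain e K where e: "w = cutrk H {v \<in> ?X. L v \<in> K}" "e \<in> edges T" "K \<in> components (delete_edge T e)"
        using w by blast
      then obtain a where a: "a \<in> ?N" "a \<noteq> ?\<rho>" "e = {a, par a}" by (auto simp: edges_T)
      then obtain A where A: "A \<in> B" "a = f A" using N_cases[of a] by auto
      have "K = desc a \<or> K = ?N - desc a" using components_delete_edge[OF a(1,2)] e a(3) by blast
      moreover have "{v \<in> ?X. L v \<in> ?N - desc a} = ?X - A"
        using desc_f[OF A(1)] single unfolding A(2) by (auto simp: L_def)
      ultimately show ?thesis using e(1) desc_f[OF A(1)] k[OF A(1)] A(2) by auto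
    qed
    \<comment> \<open>\<open>Max\<close> is meaningful only on a finite nonempty set.\<close>
    have "finite ?W" using W by (intro finite_subset[of ?W "{..k}"]) auto
    moreover have "?W \<noteq> {}"
    proof -
      have "{f D, par (f D)} \<in> edges T" using BN bf(2) neq_root by (auto simp: edges_T)
      moreover have "components (delete_edge T {f D, par (f D)}) \<noteq> {}"
        using xN by (auto simp: components_def delete_edge_def)
      ultimately show ?thesis by blast
    qed
    ultimately show ?thesis using W unfolding decomposition_width_def by simp
  qed
  have "(LEAST k. \<exists>T L. rank_decomposition H T L \<and> decomposition_width H T L = k)
      \<le> decomposition_width H T L"
    using rd by (intro Least_le exI[of _ T] exI[of _ L]) simp
  also note \<open>decomposition_width H T L \<le> k\<close>
  finally show ?thesis by (simp add: rank_width_def)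
qed

section \<open>Rank-width from an elimination order\<close>

text \<open>The ancestors of \<open>v\<close> in the elimination forest of \<open>G[Y]\<close> that removes the vertices by
  increasing \<open>L\<close>.\<close>

definition anc :: "'a graph \<Rightarrow> 'a set \<Rightarrow> ('a \<Rightarrow> nat) \<Rightarrow> 'a \<Rightarrow> 'a set" where
  "anc G Y L v = {a. \<exists>n. linked G {x \<in> Y. L a \<le> L x} n v a}"

lemma ancD:
  assumes "a \<in> anc G Y L v"
  shows "a \<in> Y" "v \<in> Y" "L a \<le> L v"
  using assms linked_in[of G _ _ v a] by (auto simp: anc_def)

lemma anc_self: "v \<in> Y \<Longrightarrow> v \<in> anc G Y L v"
  by (auto simp: anc_def intro!: linked.refl)

lemma anc_trans:
  assumes "a \<in> anc G Y L b" "b \<in> anc G Y L v"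
  shows "a \<in> anc G Y L v"
proof -
  obtain n m where l: "linked G {x \<in> Y. L a \<le> L x} n b a" "linked G {x \<in> Y. L b \<le> L x} m v b"
    using assms by (auto simp: anc_def)
  have "{x \<in> Y. L b \<le> L x} \<subseteq> {x \<in> Y. L a \<le> L x}" using ancD(3)[OF assms(1)] by auto
  with l(2) have "linked G {x \<in> Y. L a \<le> L x} m v b" by (rule linked_mono[OF _ order_refl])
  from linked_trans[OF this l(1)] show ?thesis by (auto simp: anc_def)
qed

text \<open>The walk from \<open>b\<close> back to \<open>v\<close> and on to \<open>a\<close> keeps
  to labels at least \<open>L a\<close>. So the ancestors of one vertex form a chain.\<close>

lemma anc_chain:
  assumes "a \<in> anc G Y L v" "b \<in> anc G Y L v" "L a \<le> L b"
  shows "a \<in> anc G Y L b"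
proof -
  obtain n m where l: "linked G {x \<in> Y. L a \<le> L x} n v a" "linked G {x \<in> Y. L b \<le> L x} m v b"
    using assms by (auto simp: anc_def)
  have "{x \<in> Y. L b \<le> L x} \<subseteq> {x \<in> Y. L a \<le> L x}" using assms(3) by auto
  with l(2) have "linked G {x \<in> Y. L a \<le> L x} m v b" by (rule linked_mono[OF _ order_refl])
  from linked_trans[OF linked_sym[OF this] l(1)] show ?thesis by (auto simp: anc_def)
qed

text \<open>This makes subtrees of the elimination forest separable: their edges to the outside end
  in ancestors.\<close>

lemma anc_edge:
  assumes "u \<in> Y" "v \<in> Y" "{u, v} \<in> edges G"
  shows "u \<in> anc G Y L v \<or> v \<in> anc G Y L u"
proof (cases "L u \<le> L v")
  case True
  have "linked G {x \<in> Y. L u \<le> L x} (Suc 0) v u"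
    using assms True by (intro linked_edge) (auto simp: insert_commute)
  then show ?thesis by (auto simp: anc_def)
next
  case False
  have "linked G {x \<in> Y. L v \<le> L x} (Suc 0) u v" using assms False by (intro linked_edge) auto
  then show ?thesis by (auto simp: anc_def)
qed

text \<open>Separation takes place in \<open>G[Y]\<close>, which may have vertices outside
  \<open>X\<close>. Hence \<open>A\<close> is the trace on \<open>X\<close> of some \<open>E\<close>
  whose edges to the rest of \<open>Y\<close> all meet a small set.\<close>

definition separated :: "'a graph \<Rightarrow> 'a set \<Rightarrow> nat \<Rightarrow> 'a set \<Rightarrow> 'a set \<Rightarrow> bool" where
  "separated G Y K X A \<longleftrightarrow> (\<exists>E Z. A = X \<inter> E \<and> Z \<subseteq> Y \<and> card Z \<le> K \<and>
     (\<forall>u\<in>E. \<forall>v\<in>Y - E. {u, v} \<in> edges G \<longrightarrow> u \<in> Z \<or> v \<in> Z))"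

text \<open>\<open>D\<close> is a union of subtrees of the elimination forest; \<open>Z\<close>
  consists of common ancestors and holds all ancestors outside \<open>D\<close>. If the least vertex
  of \<open>D\<close> is above all of \<open>D\<close>, it is split off and moved into
  \<open>Z\<close>; otherwise its subtree is split from the rest. \<open>Z\<close> lies in one
  ancestor set, so it has at most \<open>K\<close> members.\<close>

lemma elimination_binary_family:
  assumes Y: "finite Y" "inj_on L Y" and K: "\<And>v. v \<in> Y \<Longrightarrow> card (anc G Y L v) \<le> K"
    and D: "D \<subseteq> Y" "\<And>d v. d \<in> D \<Longrightarrow> d \<in> anc G Y L v \<Longrightarrow> v \<in> D"
      "\<And>d. d \<in> D \<Longrightarrow> anc G Y L d \<subseteq> D \<union> Z" "\<And>d. d \<in> D \<Longrightarrow> Z \<subseteq> anc G Y L d"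
    and ne: "X \<inter> D \<noteq> {}"
  shows "\<exists>B. binary_family B (X \<inter> D) \<and> (\<forall>A\<in>B. separated G Y K X A)"
  using D ne
proof (induction "card D" arbitrary: D Z rule: less_induct)
  case less
  note up = less.prems(2) and ancZ = less.prems(3) and Zanc = less.prems(4)
  have finD: "finite D" "D \<noteq> {}" using less.prems(1,5) Y(1) finite_subset by auto
  have fin_anc: "finite (anc G Y L v)" for v by (rule finite_subset[OF _ Y(1)]) (auto dest: ancD)
  have L_eq: "x = y" if "x \<in> Y" "y \<in> Y" "L x \<le> L y" "L y \<le> L x" for x y
    using Y(2) that by (auto simp: inj_on_def)
  \<comment> \<open>An edge out of \<open>D\<close> cannot go to a descendant, so it goes to an
    ancestor outside \<open>D\<close>, which lies in \<open>Z\<close>.\<close>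
  have sepD: "separated G Y K X (X \<inter> D)"
    unfolding separated_def
  proof (intro exI conjI ballI impI)
    obtain d where d: "d \<in> D" using finD by blast
    show "Z \<subseteq> Y" using Zanc[OF d] ancD(1) by fastforce
    have "card Z \<le> card (anc G Y L d)" using Zanc[OF d] fin_anc by (intro card_mono)
    then show "card Z \<le> K" using K[of d] d less.prems(1) by auto
    fix u v assume uv: "u \<in> D" "v \<in> Y - D" "{u, v} \<in> edges G"
    then have "u \<in> anc G Y L v \<or> v \<in> anc G Y L u" using less.prems(1) by (intro anc_edge) auto
    then show "u \<in> Z \<or> v \<in> Z" using up[OF uv(1)] ancZ[OF uv(1)] uv(2) by auto
  qed simp
  have "L ` D \<noteq> {}" "finite (L ` D)" using finD by auto
  then have "Min (L ` D) \<in> L ` D" by (rule Min_in[rotated])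
  then obtain d where d: "d \<in> D" "L d = Min (L ` D)" by auto
  then have d_min: "L d \<le> L v" if "v \<in> D" for v using that finD by simp
  have dY: "d \<in> Y" using d less.prems(1) by blast
  show ?case
  proof (cases "\<forall>v\<in>D. d \<in> anc G Y L v")
    case True
    let ?D = "D - {d}"
    have IH: "\<exists>B. binary_family B (X \<inter> ?D) \<and> (\<forall>A\<in>B. separated G Y K X A)" if "X \<inter> ?D \<noteq> {}"
    proof (rule less.hyps[of _ "insert d Z"])
      show "card ?D < card D" using finD d by (intro psubset_card_mono) auto
      show "?D \<subseteq> Y" using less.prems(1) by blast
      show "v \<in> ?D" if "d' \<in> ?D" "d' \<in> anc G Y L v" for d' v
      proof -
        have "v \<noteq> d"
        proof
          assume "v = d"
          then have "L d' \<le> L d" "d' \<in> Y" using ancD[OF that(2)] by auto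
          then have "d' = d" using L_eq[of d' d] d_min[of d'] that(1) dY by auto
          then show False using that by simp
        qed
        then show ?thesis using up that by blast
      qed
      show "anc G Y L d' \<subseteq> ?D \<union> insert d Z" if "d' \<in> ?D" for d' using ancZ[of d'] that by auto
      show "insert d Z \<subseteq> anc G Y L d'" if "d' \<in> ?D" for d' using Zanc[of d'] True that by auto
    qed (rule that)
    show ?thesis
    proof (cases "d \<in> X")
      case False
      then have "X \<inter> ?D = X \<inter> D" by auto
      then show ?thesis using IH less.prems(5) by simp
    next
      case dX: True
      have "separated G Y K X {d}"
        unfolding separated_def
      proof (intro exI[of _ "{d}"] conjI ballI impI)
        have "card {d} \<le> card (anc G Y L d)" using fin_anc anc_self[OF dY] by (intro card_mono) auto
        then show "card {d} \<le> K" using K[OF dY] by simp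
      qed (use dX dY in auto)
      moreover have "binary_family {{d}} {d}" by (rule binary_family.single)
      moreover have "X \<inter> D = {d} \<union> (X \<inter> ?D)" using dX d by auto
      ultimately show ?thesis
      proof (cases "X \<inter> ?D = {}")
        case True
        then have "X \<inter> D = {d}" using \<open>X \<inter> D = {d} \<union> (X \<inter> ?D)\<close> by simp
        then show ?thesis using \<open>binary_family {{d}} {d}\<close> \<open>separated G Y K X {d}\<close>
          by (intro exI[of _ "{{d}}"]) simp
      next
        case False
        then obtain B where B: "binary_family B (X \<inter> ?D)" "\<forall>A\<in>B. separated G Y K X A" using IH by blast
        have "binary_family (insert ({d} \<union> (X \<inter> ?D)) ({{d}} \<union> B)) ({d} \<union> (X \<inter> ?D))"
          by (rule binary_family.join[OF binary_family.single B(1)]) auto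
        then show ?thesis unfolding \<open>X \<inter> D = {d} \<union> (X \<inter> ?D)\<close>[symmetric]
          using B(2) sepD \<open>separated G Y K X {d}\<close>
          by (intro exI[of _ "insert (X \<inter> D) ({{d}} \<union> B)"]) simp
      qed
    qed
  next
    case False
    \<comment> \<open>The subtree rooted at \<open>d\<close>, against the remaining trees. Both
      parts are smaller than \<open>D\<close>, but one of them may miss \<open>X\<close>.\<close>
    define D1 where "D1 = {v \<in> D. d \<in> anc G Y L v}"
    define D2 where "D2 = D - D1"
    have D12: "D1 \<union> D2 = D" "D1 \<inter> D2 = {}" "D1 \<subset> D" "D2 \<subset> D"
      using False d anc_self[OF dY] by (auto simp: D1_def D2_def)
    have D1_up: "v \<in> D1" if "d' \<in> D1" "d' \<in> anc G Y L v" for d' v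
      using that up anc_trans[of d G Y L d' v] by (auto simp: D1_def)
    have D1_down: "a \<in> D1" if "v \<in> D1" "a \<in> anc G Y L v" "a \<in> D" for a v
      using that d_min[of a] anc_chain[of d G Y L v a] by (auto simp: D1_def)
    have IH: "\<exists>B. binary_family B (X \<inter> D') \<and> (\<forall>A\<in>B. separated G Y K X A)"
      if D': "D' = D1 \<or> D' = D2" "X \<inter> D' \<noteq> {}" for D'
    proof (rule less.hyps[of _ Z])
      show "card D' < card D" using D12 D'(1) finD by (auto intro!: psubset_card_mono)
      show "D' \<subseteq> Y" using D12 D'(1) less.prems(1) by blast
      show "v \<in> D'" if "d' \<in> D'" "d' \<in> anc G Y L v" for d' v
      proof (cases "D' = D1")
        case False
        then have "D' = D2" using D' by blast
        then have d': "d' \<in> D" "d' \<notin> D1" using that(1) by (auto simp: D2_def)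
        then have "v \<in> D" "v \<notin> D1" using up that(2) D1_down by blast+
        then show ?thesis using \<open>D' = D2\<close> by (simp add: D2_def)
      qed (use that D1_up in blast)
      show "anc G Y L d' \<subseteq> D' \<union> Z" if d': "d' \<in> D'" for d'
      proof
        fix a assume a: "a \<in> anc G Y L d'"
        have "d' \<in> D" using d' D'(1) D12 by blast
        then have "a \<in> D \<union> Z" using a ancZ by blast
        moreover have "a \<in> D'" if "a \<in> D"
          using d' D'(1) D1_down[OF _ a that] D1_up[OF _ a] that by (auto simp: D2_def)
        ultimately show "a \<in> D' \<union> Z" by blast
      qed
      show "Z \<subseteq> anc G Y L d'" if "d' \<in> D'" for d' using Zanc[of d'] that D'(1) D12 by blast
    qed (rule that(2))
    consider "X \<inter> D1 = {}" | "X \<inter> D2 = {}" | "X \<inter> D1 \<noteq> {}" "X \<inter> D2 \<noteq> {}" by blast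
    then show ?thesis
    proof cases
      case 1
      then have "X \<inter> D2 = X \<inter> D" using D12(1) by auto
      then show ?thesis using IH[of D2] less.prems(5) by simp
    next
      case 2
      then have "X \<inter> D1 = X \<inter> D" using D12(1) by auto
      then show ?thesis using IH[of D1] less.prems(5) by simp
    next
      case 3
      then obtain B1 B2 where B: "binary_family B1 (X \<inter> D1)" "\<forall>A\<in>B1. separated G Y K X A"
        "binary_family B2 (X \<inter> D2)" "\<forall>A\<in>B2. separated G Y K X A"
        using IH[of D1] IH[of D2] by auto
      have XD: "X \<inter> D = (X \<inter> D1) \<union> (X \<inter> D2)" using D12(1) by auto
      have "binary_family (insert ((X \<inter> D1) \<union> (X \<inter> D2)) (B1 \<union> B2)) ((X \<inter> D1) \<union> (X \<inter> D2))"
        by (rule binary_family.join[OF B(1,3)]) (use D12(2) in auto)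
      then have "binary_family (insert (X \<inter> D) (B1 \<union> B2)) (X \<inter> D)" unfolding XD .
      moreover have "\<forall>A\<in>insert (X \<inter> D) (B1 \<union> B2). separated G Y K X A" using B(2,4) sepD by auto
      ultimately show ?thesis by (intro exI conjI)
    qed
  qed
qed

section \<open>Cut-rank across a separator\<close>

text \<open>Some edge of the walk leaves \<open>E\<close>, and its end in \<open>Z\<close> cuts the
  walk.\<close>

lemma linked_through_separator:
  assumes "linked G Y n u v" "u \<in> E" "v \<notin> E"
    and "\<And>u v. u \<in> E \<Longrightarrow> v \<in> Y - E \<Longrightarrow> {u, v} \<in> edges G \<Longrightarrow> u \<in> Z \<or> v \<in> Z"
  shows "\<exists>z\<in>Z. \<exists>i j. i + j \<le> n \<and> linked G Y i u z \<and> linked G Y j z v"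
  using assms(1-3)
proof (induction)
  case (step u w n v)
  have w: "w \<in> Y" using linked_in(1)[OF step(3)] .
  consider "w \<in> E" | "w \<notin> E" "u \<in> Z" | "w \<notin> E" "w \<in> Z" using assms(4) step w by blast
  then show ?case
  proof cases
    case 1
    then obtain z i j where z: "z \<in> Z" "i + j \<le> n" "linked G Y i w z" "linked G Y j z v"
      using step by blast
    then have "linked G Y (Suc i) u z" using step by (auto intro: linked.step)
    then show ?thesis using z by (intro bexI[of _ z] exI[of _ "Suc i"] exI[of _ j]) auto
  next
    case 2
    have "linked G Y (Suc n) u v" using step by (auto intro: linked.step)
    then show ?thesis using 2 step
      by (intro bexI[of _ u] exI[of _ 0] exI[of _ "Suc n"]) (auto intro: linked.refl)
  next
    case 3
    have "linked G Y (Suc 0) u w" using step w by (auto intro: linked_edge)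
    then show ?thesis using 3 step by (intro bexI[of _ w] exI[of _ "Suc 0"] exI[of _ n]) auto
  qed
qed simp

text \<open>A row of the cut matrix is determined by the distances, up to \<open>r\<close>, to the separator \<open>Z\<close>.\<close>

lemma cutrk_le_of_separator:
  assumes A: "A \<subseteq> vertices H" and Z: "finite Z" "card Z \<le> K"
    and edge: "\<And>u v. u \<in> vertices H \<Longrightarrow> v \<in> vertices H \<Longrightarrow> u \<noteq> v \<Longrightarrow>
      {u, v} \<in> edges H \<longleftrightarrow> linked G Y r u v"
    and sep: "\<And>u v. u \<in> A \<Longrightarrow> v \<in> vertices H - A \<Longrightarrow> linked G Y r u v \<Longrightarrow>
      \<exists>z\<in>Z. \<exists>i j. i + j \<le> r \<and> linked G Y i u z \<and> linked G Y j z v"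
  shows "cutrk H A \<le> 2 ^ (K * (r + 1))"
proof -
  interpret vector_space scale_fun by (rule vector_space_scale_fun)
  \<comment> \<open>Linkage for each \<open>j\<close> up to \<open>r\<close> records the distance to
    \<open>z\<close> inside \<open>Y\<close>, truncated at \<open>r\<close>.\<close>
  define sig where "sig u = {(z, j). z \<in> Z \<and> j \<le> r \<and> linked G Y j u z}" for u
  have sig: "sig u \<in> Pow (Z \<times> {..r})" for u by (auto simp: sig_def)
  have fin: "finite (Pow (Z \<times> {..r}))" using Z by simp
  have half: "{u', v} \<in> edges H" if uv: "sig u \<subseteq> sig u'" "u \<in> A" "u' \<in> A" "v \<in> vertices H - A"
    "{u, v} \<in> edges H" for u u' v
  proof -
    have "linked G Y r u v" using uv A edge[of u v] by auto
    then obtain z i j where z: "z \<in> Z" "i + j \<le> r" "linked G Y i u z" "linked G Y j z v"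
      using sep[OF uv(2,4)] by blast
    then have "(z, i) \<in> sig u" by (simp add: sig_def)
    then have "(z, i) \<in> sig u'" using uv(1) by blast
    then have "linked G Y i u' z" by (simp add: sig_def)
    then have "linked G Y r u' v" by (rule linked_mono[OF linked_trans[OF _ z(4)] z(2) order_refl])
    then show ?thesis using uv A edge[of u' v] by auto
  qed
  have row: "cut_row H A u = cut_row H A u'" if "u \<in> A" "u' \<in> A" "sig u = sig u'" for u u'
    using half[of u u'] half[of u' u] that unfolding cut_row_def by (intro ext) auto
  have "cut_row H A ` A \<subseteq> (\<lambda>s. cut_row H A (SOME u. u \<in> A \<and> sig u = s)) ` sig ` A"
  proof
    fix f assume "f \<in> cut_row H A ` A"
    then obtain u where u: "u \<in> A" "f = cut_row H A u" by blast
    then have "(SOME u'. u' \<in> A \<and> sig u' = sig u) \<in> A \<and> sig (SOME u'. u' \<in> A \<and> sig u' = sig u) = sig u"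
      by (intro someI[of "\<lambda>u'. u' \<in> A \<and> sig u' = sig u" u]) simp
    then have "f = cut_row H A (SOME u'. u' \<in> A \<and> sig u' = sig u)" using u row by metis
    then show "f \<in> (\<lambda>s. cut_row H A (SOME u. u \<in> A \<and> sig u = s)) ` sig ` A" using u by blast
  qed
  note sub = this
  have sigA: "finite (sig ` A)" "sig ` A \<subseteq> Pow (Z \<times> {..r})"
    using sig finite_subset[OF _ fin, of "sig ` A"] by auto
  have fin_row: "finite (cut_row H A ` A)" using finite_subset[OF sub finite_imageI[OF sigA(1)]] .
  \<comment> \<open>The rank is at most the number of different rows, hence at most the number of
    signatures, which are subsets of \<open>Z \<times> {..r}\<close>.\<close>
  have "card (cut_row H A ` A) \<le> card (sig ` A)" using surj_card_le[OF sigA(1) sub] .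
  moreover have "card (sig ` A) \<le> card (Pow (Z \<times> {..r}))" using fin sigA by (intro card_mono)
  moreover have "card (Pow (Z \<times> {..r})) = 2 ^ (card Z * (r + 1))"
    using Z by (simp add: card_Pow card_cartesian_product)
  moreover have "(2::nat) ^ (card Z * (r + 1)) \<le> 2 ^ (K * (r + 1))"
    using Z(2) by (intro power_increasing mult_right_mono) auto
  moreover have "cutrk H A \<le> card (cut_row H A ` A)" unfolding cutrk_def using fin_row by (rule dim_le_card')
  ultimately show ?thesis by linarith
qed

text \<open>One vertex \<open>x0\<close> is set aside as root leaf and the family is built on the
  others. \<open>x0\<close> is outside \<open>A\<close> but may lie in \<open>E\<close>, where walks
  to it need not cross \<open>Z\<close>; so it joins every separator, hence
  \<open>K + 1\<close>.\<close>

lemma rank_width_le_of_elimination: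
  assumes Y: "finite Y" "inj_on L Y" and K: "\<And>v. v \<in> Y \<Longrightarrow> card (anc G Y L v) \<le> K"
    and H: "vertices H \<subseteq> Y"
    and edge: "\<And>u v. u \<in> vertices H \<Longrightarrow> v \<in> vertices H \<Longrightarrow> u \<noteq> v \<Longrightarrow>
      {u, v} \<in> edges H \<longleftrightarrow> linked G Y r u v"
  shows "rank_width H \<le> 2 ^ ((K + 1) * (r + 1))"
proof (cases "card (vertices H) \<le> 1")
  case True
  then show ?thesis by (simp add: rank_width_def)
next
  case False
  let ?X = "vertices H"
  have fin: "finite ?X" using H Y finite_subset by blast
  from False obtain x0 where x0: "x0 \<in> ?X" by fastforce
  define X where "X = ?X - {x0}"
  have "card X \<noteq> 0" using False fin x0 by (simp add: X_def)
  moreover have XY: "X \<inter> Y = X" using H by (auto simp: X_def)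
  ultimately have "X \<inter> Y \<noteq> {}" by auto
  have "\<exists>B. binary_family B (X \<inter> Y) \<and> (\<forall>A\<in>B. separated G Y K X A)"
    by (rule elimination_binary_family[where Z = "{}", OF Y K])
      (use \<open>X \<inter> Y \<noteq> {}\<close> in \<open>auto dest: ancD\<close>)
  with XY obtain B where B: "binary_family B X" "\<forall>A\<in>B. separated G Y K X A" by auto
  show ?thesis
  proof (rule binary_family_rank_width[OF fin x0 B(1)[unfolded X_def]])
    fix A assume "A \<in> B"
    then obtain E Z where EZ: "A = X \<inter> E" "Z \<subseteq> Y" "card Z \<le> K"
      "\<And>u v. u \<in> E \<Longrightarrow> v \<in> Y - E \<Longrightarrow> {u, v} \<in> edges G \<Longrightarrow> u \<in> Z \<or> v \<in> Z"
      using B(2) unfolding separated_def by meson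
    have Z: "finite (insert x0 Z)" "card (insert x0 Z) \<le> K + 1"
      using EZ(2,3) Y finite_subset[of Z Y] by (auto simp: card_insert_if)
    have sep: "\<exists>z\<in>insert x0 Z. \<exists>i j. i + j \<le> r \<and> linked G Y i u z \<and> linked G Y j z v"
      if "u \<in> A" "v \<in> ?X - A" "linked G Y r u v" for u v
    proof (cases "v = x0")
      case True
      then show ?thesis using that x0 H
        by (intro bexI[of _ x0] exI[of _ r] exI[of _ 0]) (auto intro: linked.refl)
    next
      case False
      then have "u \<in> E" "v \<notin> E" using that EZ(1) by (auto simp: X_def)
      then show ?thesis using linked_through_separator[OF that(3) _ _ EZ(4)] by blast
    qed
    have A: "A \<subseteq> ?X" using EZ(1) by (auto simp: X_def)
    have "cutrk H A \<le> 2 ^ ((K + 1) * (r + 1))" by (rule cutrk_le_of_separator[OF A Z edge sep])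
    moreover have "cutrk H (?X - A) \<le> 2 ^ ((K + 1) * (r + 1))"
    \<comment> \<open>Reversing walks lets the same separator serve the complement.\<close>
    proof (rule cutrk_le_of_separator[OF _ Z edge])
      fix u v assume "u \<in> ?X - A" "v \<in> ?X - (?X - A)" "linked G Y r u v"
      then have "v \<in> A" "linked G Y r v u" using linked_sym by auto
      then obtain z i j where "z \<in> insert x0 Z" "i + j \<le> r" "linked G Y i v z" "linked G Y j z u"
        using sep \<open>u \<in> ?X - A\<close> by blast
      then have "z \<in> insert x0 Z" "j + i \<le> r" "linked G Y j u z" "linked G Y i z v"
        using linked_sym by auto
      then show "\<exists>z\<in>insert x0 Z. \<exists>i j. i + j \<le> r \<and> linked G Y i u z \<and> linked G Y j z v" by blast
    qed auto
    ultimately show "cutrk H A \<le> 2 ^ ((K + 1) * (r + 1)) \<and> cutrk H (?X - A) \<le> 2 ^ ((K + 1) * (r + 1))" ..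
  qed
qed

section \<open>Colourings from weak reachability\<close>

text \<open>A vertex of unique colour cuts a segment into two pieces that both lack this colour, so
  with one more colour a length is at most \<open>1 + 2 * (2 ^ q - 1)\<close>. Only bounded segments
  are assumed to have such a vertex, since weak reachability controls only bounded lengths.\<close>

lemma length_less_of_unique_colours:
  assumes "\<And>xs ys zs. p = xs @ ys @ zs \<Longrightarrow> ys \<noteq> [] \<Longrightarrow> length ys \<le> 2 ^ q \<Longrightarrow>
      \<exists>y\<in>set ys. \<forall>x\<in>set ys. x \<noteq> y \<longrightarrow> c x \<noteq> c y"
    and "distinct p" "card (c ` set p) \<le> q"
  shows "length p < 2 ^ q"
  using assms
proof (induction q arbitrary: p)
  case 0
  then show ?case by simp
next
  case (Suc q)
  show ?case
  proof (rule ccontr)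
    assume "\<not> ?thesis"
    \<comment> \<open>A prefix of length exactly \<open>2 ^ Suc q\<close> is examined, since the
      whole list may be too long for the assumption.\<close>
    then have len: "length (take (2 ^ Suc q) p) = 2 ^ Suc q" by simp
    moreover have "take (2 ^ Suc q) p \<noteq> []" using len by (metis length_0_conv power_not_zero zero_neq_numeral)
    ultimately obtain y where y: "y \<in> set (take (2 ^ Suc q) p)"
      "\<forall>x\<in>set (take (2 ^ Suc q) p). x \<noteq> y \<longrightarrow> c x \<noteq> c y"
      using Suc.prems(1)[of "[]" "take (2 ^ Suc q) p" "drop (2 ^ Suc q) p"] by auto
    obtain xs zs where xz: "take (2 ^ Suc q) p = xs @ y # zs" using y(1) by (meson split_list)
    define rest where "rest = drop (2 ^ Suc q) p"
    have p: "p = xs @ y # zs @ rest"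
      using append_take_drop_id[of "2 ^ Suc q" p] unfolding xz rest_def by simp
    have yp: "y \<in> set p" by (subst p) simp
    have short: "length l < 2 ^ q" if l: "l = xs \<or> l = zs" for l
    proof (rule Suc.IH)
      have "\<exists>as bs. p = as @ l @ bs"
      proof (cases "l = xs")
        case True
        then show ?thesis using p by (intro exI[of _ "[]"] exI[of _ "y # zs @ rest"]) simp
      next
        case False
        then have "p = (xs @ [y]) @ l @ rest" using p l by simp
        then show ?thesis by blast
      qed
      then obtain as bs where ab: "p = as @ l @ bs" by blast
      fix us vs ws assume l': "l = us @ vs @ ws" "vs \<noteq> []" "length vs \<le> 2 ^ q"
      then have "p = (as @ us) @ vs @ (ws @ bs)" using ab by simp
      then show "\<exists>y\<in>set vs. \<forall>x\<in>set vs. x \<noteq> y \<longrightarrow> c x \<noteq> c y"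
        by (rule Suc.prems(1)) (use l' in auto)
    next
      have d: "distinct (xs @ y # zs)" unfolding xz[symmetric] using Suc.prems(2) by simp
      then show "distinct l" using l by auto
      have "set l \<subseteq> set p" using l set_take_subset[of "2 ^ Suc q" p] unfolding xz by auto
      moreover have "\<forall>x\<in>set l. c x \<noteq> c y" using y(2) d l unfolding xz by auto
      ultimately have "c ` set l \<subseteq> c ` set p - {c y}" by auto
      then have "card (c ` set l) \<le> card (c ` set p - {c y})" by (intro card_mono) auto
      also have "\<dots> \<le> q" using yp Suc.prems(3) by (simp add: card_Diff_singleton)
      finally show "card (c ` set l) \<le> q" .
    qed
    have "length xs < 2 ^ q" "length zs < 2 ^ q" using short by auto
    then show False using len unfolding xz by simp
  qed
qed

lemma walk_linked_members:
  assumes "walk G p" "x \<in> set p" "y \<in> set p"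
  shows "linked G (set p) (2 * length p) x y"
proof -
  have hd: "linked G (set p) (length p) (hd p) z" if z: "z \<in> set p" for z
  proof -
    obtain xs ys where p: "p = xs @ z # ys" using z by (meson split_list)
    have "walk G (xs @ [z])"
    proof (cases "ys = []")
      case False
      have "p = (xs @ [z]) @ ys" using p by simp
      then show ?thesis using assms(1) False walk_append[of "xs @ [z]" ys G] by simp
    qed (use p assms(1) in simp)
    then have "linked G (set (xs @ [z])) (length (xs @ [z]) - 1) (hd (xs @ [z])) z"
      using walk_linked by fastforce
    moreover have "hd (xs @ [z]) = hd p" using p by (cases xs) auto
    ultimately show ?thesis using p by (auto elim!: linked_mono)
  qed
  show ?thesis using linked_trans[OF linked_sym[OF hd[OF assms(2)]] hd[OF assms(3)]] by (simp add: mult_2)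
qed

text \<open>On a shortest walk to \<open>a\<close> inside \<open>Y\<close>, the least vertex of any
  short segment is weakly reached from the whole segment and so has a unique colour there. With at
  most \<open>q\<close> colours the walk is short, so its length need not be bounded in
  advance.\<close>

lemma anc_subset_wreach:
  fixes L :: "'a \<Rightarrow> nat"
  assumes Y: "Y \<subseteq> vertices G" "finite Y"
    and c: "\<And>u v. v \<in> vertices G \<Longrightarrow> u \<in> wreach G L (2 ^ Suc q) v \<Longrightarrow> u \<noteq> v \<Longrightarrow> c u \<noteq> c v"
    and q: "card (c ` Y) \<le> q"
  shows "anc G Y L v \<subseteq> wreach G L (2 ^ Suc q) v"
proof
  fix a assume a: "a \<in> anc G Y L v"
  let ?B = "{x \<in> Y. L a \<le> L x}"
  have BV: "?B \<subseteq> vertices G" using Y by auto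
  define W where "W p \<longleftrightarrow> walk G p \<and> hd p = v \<and> last p = a \<and> set p \<subseteq> ?B" for p
  have "\<exists>p. W p" using a linked_walk[OF _ BV] unfolding anc_def W_def by blast
  then obtain p where p: "W p" and min: "\<And>p'. W p' \<Longrightarrow> length p \<le> length p'"
    using ex_has_least_nat[of W _ length] by metis
  \<comment> \<open>A repeated vertex would allow a shortcut.\<close>
  have "distinct p"
  proof (rule ccontr)
    assume "\<not> distinct p"
    then obtain xs ys zs x where d: "p = xs @ [x] @ ys @ [x] @ zs" using not_distinct_decomp by blast
    have "W (xs @ [x] @ zs)"
      using p unfolding d W_def walk_def by (cases "xs = []"; cases "zs = []")
        (auto simp: successively_append_iff successively_Cons hd_append)
    from min[OF this] show False unfolding d by simp
  qed
  have "length p < 2 ^ q"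
  proof (rule length_less_of_unique_colours[of p q c])
    fix xs ys zs assume ys: "p = xs @ ys @ zs" "ys \<noteq> []" "length ys \<le> 2 ^ q"
    have wp: "walk G p" "set p \<subseteq> vertices G" using p BV by (auto simp: W_def)
    have walk: "walk G ys"
      using wp(1) ys(2) unfolding ys(1) walk_def by (auto simp: successively_append_iff)
    have "L ` set ys \<noteq> {}" using ys by simp
    then have "Min (L ` set ys) \<in> L ` set ys" by (intro Min_in) auto
    then obtain y where y: "y \<in> set ys" "L y = Min (L ` set ys)" by auto
    have "c x \<noteq> c y" if x: "x \<in> set ys" "x \<noteq> y" for x
    proof -
      \<comment> \<open>The detour through the head of the segment doubles the length; this is the
        reason for \<open>Suc q\<close> in the exponent.\<close>
      have "linked G (set ys) (2 * length ys) x y" using walk_linked_members[OF walk x(1) y(1)] .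
      moreover have "set ys \<subseteq> {z \<in> vertices G. L y \<le> L z}" using y(2) wp(2) unfolding ys(1) by auto
      moreover have "2 * length ys \<le> 2 ^ Suc q" using ys(3) by simp
      ultimately have "y \<in> wreach G L (2 ^ Suc q) x" unfolding wreach_def by (auto intro: linked_mono)
      moreover have "x \<in> vertices G" using x wp(2) unfolding ys(1) by auto
      ultimately show ?thesis using c[of x y] x(2) by metis
    qed
    then show "\<exists>y\<in>set ys. \<forall>x\<in>set ys. x \<noteq> y \<longrightarrow> c x \<noteq> c y" using y(1) by blast
  next
    have "c ` set p \<subseteq> c ` Y" using p by (auto simp: W_def)
    then show "card (c ` set p) \<le> q" using q Y(2) card_mono[of "c ` Y" "c ` set p"] by simp
  qed (fact \<open>distinct p\<close>)
  moreover have "linked G (set p) (length p - 1) v a" using p walk_linked[of G p] by (auto simp: W_def)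
  moreover have "set p \<subseteq> {x \<in> vertices G. L a \<le> L x}" using p BV by (auto simp: W_def)
  ultimately have "linked G {x \<in> vertices G. L a \<le> L x} (2 ^ Suc q) v a" by (auto elim!: linked_mono)
  then show "a \<in> wreach G L (2 ^ Suc q) v" by (simp add: wreach_def)
qed

text \<open>Colours are chosen greedily by increasing label. All other vertices weakly reached from
  \<open>v\<close> have smaller labels, and there are at most \<open>w\<close> of them, so one of
  \<open>w + 1\<close> colours is free.\<close>

lemma wreach_colouring:
  fixes L :: "'a \<Rightarrow> nat"
  assumes fin: "finite (vertices G)" and L: "inj_on L (vertices G)"
    and w: "\<And>v. v \<in> vertices G \<Longrightarrow> card (wreach G L n v) \<le> w"
  obtains c :: "'a \<Rightarrow> nat" where "c ` vertices G \<subseteq> {..w}"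
    "\<And>u v. v \<in> vertices G \<Longrightarrow> u \<in> wreach G L n v \<Longrightarrow> u \<noteq> v \<Longrightarrow> c u \<noteq> c v"
proof -
  let ?V = "vertices G"
  have less: "L u < L v" if "v \<in> ?V" "u \<in> wreach G L n v" "u \<noteq> v" for u v
  proof -
    have "L u \<le> L v" using that(2) linked_in(1)[of G "{x \<in> ?V. L u \<le> L x}" n v u] by (simp add: wreach_def)
    moreover have "u \<in> ?V" by (rule subsetD[OF wreach_subset that(2)])
    ultimately show ?thesis using L that by (auto simp: inj_on_def order.order_iff_strict)
  qed
  have "\<exists>c :: 'a \<Rightarrow> nat. \<forall>v\<in>?V. L v < m \<longrightarrow> c v \<le> w \<and> (\<forall>u\<in>wreach G L n v. u \<noteq> v \<longrightarrow> c u \<noteq> c v)" for m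
  proof (induction m)
    case (Suc m)
    then obtain c :: "'a \<Rightarrow> nat" where c: "\<And>v. v \<in> ?V \<Longrightarrow> L v < m \<Longrightarrow>
        c v \<le> w \<and> (\<forall>u\<in>wreach G L n v. u \<noteq> v \<longrightarrow> c u \<noteq> c v)" by blast
    show ?case
    proof (cases "\<exists>v\<in>?V. L v = m")
      case False
      then have "L v < m" if "v \<in> ?V" "L v < Suc m" for v using that by (auto simp: less_Suc_eq)
      then show ?thesis using c by blast
    next
      case True
      then obtain v where v: "v \<in> ?V" "L v = m" by blast
      have "card (c ` wreach G L n v) \<le> w"
        using w[OF v(1)] card_image_le[of "wreach G L n v" c] finite_subset[OF wreach_subset fin] by fastforce
      then have "card (c ` wreach G L n v) < card {..w}" by simp
      then have "\<not> {..w} \<subseteq> c ` wreach G L n v"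
        using card_mono[of "c ` wreach G L n v" "{..w}"] finite_subset[OF wreach_subset fin] by fastforce
      then obtain d where d: "d \<le> w" "d \<notin> c ` wreach G L n v" by blast
      have "(c(v := d)) x \<le> w \<and> (\<forall>u\<in>wreach G L n x. u \<noteq> x \<longrightarrow> (c(v := d)) u \<noteq> (c(v := d)) x)"
        if x: "x \<in> ?V" "L x < Suc m" for x
      proof (cases "x = v")
        case True
        then show ?thesis using d by auto
      next
        case False
        then have "L x < m" using L x v by (auto simp: inj_on_def less_Suc_eq)
        moreover have "u \<noteq> v" if "u \<in> wreach G L n x" "u \<noteq> x" for u
          using less[OF x(1) that] \<open>L x < m\<close> v(2) by auto
        ultimately show ?thesis using c[OF x(1)] False by auto
      qed
      then show ?thesis by blast
    qed
  qed simp
  from this[of "Suc (Max (L ` ?V))"] obtain c :: "'a \<Rightarrow> nat" where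
    c: "\<forall>v\<in>?V. L v < Suc (Max (L ` ?V)) \<longrightarrow> c v \<le> w \<and> (\<forall>u\<in>wreach G L n v. u \<noteq> v \<longrightarrow> c u \<noteq> c v)" by blast
  have "L v < Suc (Max (L ` ?V))" if "v \<in> ?V" for v using that fin by (simp add: less_Suc_eq_le)
  then show thesis using c by (intro that[of c]) auto
qed

text \<open>A shortest path of length at most \<open>r\<close> between \<open>u\<close> and \<open>v\<close> has a minimum that both ends weakly
  reach, so it may be rerouted inside the closures of its ends.\<close>

lemma wreach_closure:
  fixes L :: "'a \<Rightarrow> nat"
  assumes fin: "finite (vertices G)"
  obtains Cl :: "'a \<Rightarrow> 'a set" where
    "\<And>u. u \<in> vertices G \<Longrightarrow> Cl u \<subseteq> vertices G"
    "\<And>u. u \<in> vertices G \<Longrightarrow> u \<in> Cl u"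
    "\<And>u. u \<in> vertices G \<Longrightarrow> card (Cl u) \<le> card (wreach G L r u) * (r + 1)"
    "\<And>u v. u \<in> vertices G \<Longrightarrow> v \<in> vertices G \<Longrightarrow> linked G (vertices G) r u v \<Longrightarrow>
      linked G (Cl u \<union> Cl v) r u v"
proof -
  let ?V = "vertices G"
  have "\<exists>B\<subseteq>?V. u \<in> B \<and> card B \<le> r + 1 \<and> (\<forall>j\<le>r. linked G ?V j u m \<longrightarrow> linked G B j u m)"
    if m: "m \<in> wreach G L r u" for u m
  proof -
    have ex: "linked G ?V r u m" using m unfolding wreach_def by (auto elim!: linked_mono)
    \<comment> \<open>A shortest walk to \<open>m\<close> serves all bounds up to \<open>r\<close>
      at once.\<close>
    define j where "j = (LEAST j. linked G ?V j u m)"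
    have j: "linked G ?V j u m" "j \<le> r" unfolding j_def using ex by (auto intro: LeastI Least_le)
    have least: "j \<le> i" if "linked G ?V i u m" for i unfolding j_def using that by (rule Least_le)
    obtain B where "B \<subseteq> ?V" "finite B" "card B \<le> Suc j" "linked G B j u m" "u \<in> B"
      by (rule linked_path[OF j(1)]) (rule that)
    then show ?thesis using j(2) least by (intro exI[of _ B]) (auto intro: linked_mono)
  qed
  then have "\<forall>u. \<forall>m\<in>wreach G L r u. \<exists>B. B \<subseteq> ?V \<and> u \<in> B \<and> card B \<le> r + 1 \<and>
      (\<forall>j\<le>r. linked G ?V j u m \<longrightarrow> linked G B j u m)" by blast
  then obtain B where B: "\<forall>u. \<forall>m\<in>wreach G L r u. B u m \<subseteq> ?V \<and> u \<in> B u m \<and> card (B u m) \<le> r + 1 \<and>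
      (\<forall>j\<le>r. linked G ?V j u m \<longrightarrow> linked G (B u m) j u m)" by metis
  define Cl where "Cl u = (\<Union>m\<in>wreach G L r u. B u m)" for u
  have cl: "linked G (Cl u) j u m" if "m \<in> wreach G L r u" "j \<le> r" "linked G ?V j u m" for u m j
  proof -
    have "linked G (B u m) j u m" using B that by blast
    moreover have "B u m \<subseteq> Cl u" using that(1) by (auto simp: Cl_def)
    ultimately show ?thesis by (rule linked_mono[OF _ order_refl])
  qed
  show thesis
  proof (rule that[of Cl])
    fix u assume u: "u \<in> ?V"
    show "Cl u \<subseteq> ?V" using B by (auto simp: Cl_def)
    show "u \<in> Cl u" using B wreach_self[OF u, of L r] unfolding Cl_def by blast
    have "card (Cl u) \<le> (\<Sum>m\<in>wreach G L r u. card (B u m))"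
      unfolding Cl_def by (rule card_UN_le[OF finite_subset[OF wreach_subset fin]])
    also have "\<dots> \<le> (\<Sum>m\<in>wreach G L r u. r + 1)" using B by (intro sum_mono) blast
    finally show "card (Cl u) \<le> card (wreach G L r u) * (r + 1)" by simp
  next
    fix u v assume uv: "linked G ?V r u v"
    obtain m i j where m: "i + j \<le> r" "linked G {x \<in> ?V. L m \<le> L x} i u m"
      "linked G {x \<in> ?V. L m \<le> L x} j m v" using linked_min[OF uv, of L] by blast
    have V: "{x \<in> ?V. L m \<le> L x} \<subseteq> ?V" by blast
    have "m \<in> wreach G L r u" using m(1) by (auto simp: wreach_def intro: linked_mono[OF m(2)])
    then have 1: "linked G (Cl u) i u m" using m(1) by (intro cl linked_mono[OF m(2) order_refl V]) auto
    have "m \<in> wreach G L r v"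
      using m(1) by (auto simp: wreach_def intro: linked_mono[OF linked_sym[OF m(3)]])
    then have 2: "linked G (Cl v) j v m"
      using m(1) by (intro cl linked_mono[OF linked_sym[OF m(3)] order_refl V]) auto
    have "linked G (Cl u \<union> Cl v) (i + j) u v"
      using linked_mono[OF 1 order_refl, of "Cl u \<union> Cl v"]
        linked_mono[OF linked_sym[OF 2] order_refl, of "Cl u \<union> Cl v"] by (auto intro: linked_trans)
    then show "linked G (Cl u \<union> Cl v) r u v" using m(1) by (rule linked_mono) auto
  qed
qed

section \<open>Low rank-width colourings of powers\<close>

lemma graph_power_edge_iff:
  assumes "u \<in> vertices G" "v \<in> vertices G" "u \<noteq> v"
  shows "{u, v} \<in> edges (graph_power G r) \<longleftrightarrow> linked G (vertices G) r u v"
  using assms linked_sym[of G "vertices G" r]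
  by (auto simp: graph_power_def gdist_le_iff doubleton_eq_iff)

text \<open>The colour of \<open>u\<close> is the set of base colours on the closure of \<open>u\<close>: few new colours on \<open>X\<close>
  mean few base colours on the union of the closures, where distances up to \<open>r\<close> between vertices of
  \<open>X\<close> are preserved.\<close>

lemma power_colouring:
  fixes C :: "'a graph set"
  assumes "\<And>G. G \<in> C \<Longrightarrow> simple_graph G" "bounded_expansion C"
  obtains N Q :: nat where "\<And>G. G \<in> C \<Longrightarrow> \<exists>col :: 'a \<Rightarrow> nat. col ` vertices G \<subseteq> {..<N} \<and>
    (\<forall>X\<subseteq>vertices G. card (col ` X) \<le> i \<longrightarrow> rank_width (induced_subgraph (graph_power G r) X) \<le> Q)"
proof -
  obtain w1 :: nat where w1: "\<And>G. G \<in> C \<Longrightarrow> \<exists>L :: 'a \<Rightarrow> nat. inj_on L (vertices G) \<and>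
      (\<forall>v\<in>vertices G. card (wreach G L r v) \<le> w1)"
    by (rule bounded_expansion_wreach[OF assms, of r]) blast+
  \<comment> \<open>\<open>X\<close> shows at most \<open>i\<close> colour sets, each with at most
    \<open>w1 * (r + 1)\<close> base colours. The second order has to wait for this number, which
    fixes the length \<open>2 ^ Suc q\<close>.\<close>
  define q where "q = i * (w1 * (r + 1))"
  obtain w2 :: nat where w2: "\<And>G. G \<in> C \<Longrightarrow> \<exists>L :: 'a \<Rightarrow> nat. inj_on L (vertices G) \<and>
      (\<forall>v\<in>vertices G. card (wreach G L (2 ^ Suc q) v) \<le> w2)"
    by (rule bounded_expansion_wreach[OF assms, of "2 ^ Suc q"]) blast+
  have "finite (Pow {..w2})" by simp
  \<comment> \<open>Sets of base colours are numbered so that they can serve as colours.\<close>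
  then obtain code :: "nat set \<Rightarrow> nat" where code: "bij_betw code (Pow {..w2}) {..<card (Pow {..w2})}"
    using ex_bij_betw_finite_nat lessThan_atLeast0 by metis
  show thesis
  proof (rule that[of "card (Pow {..w2})" "2 ^ ((w2 + 1) * (r + 1))"])
    fix G assume G: "G \<in> C"
    let ?V = "vertices G"
    have fin: "finite ?V" using assms(1)[OF G] by (simp add: simple_graph_def)
    obtain L1 :: "'a \<Rightarrow> nat" where L1: "inj_on L1 ?V" "\<And>v. v \<in> ?V \<Longrightarrow> card (wreach G L1 r v) \<le> w1"
      using w1[OF G] by blast
    obtain L2 :: "'a \<Rightarrow> nat" where L2: "inj_on L2 ?V"
      "\<And>v. v \<in> ?V \<Longrightarrow> card (wreach G L2 (2 ^ Suc q) v) \<le> w2"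
      using w2[OF G] by blast
    obtain Cl :: "'a \<Rightarrow> 'a set" where Cl: "\<And>u. u \<in> ?V \<Longrightarrow> Cl u \<subseteq> ?V" "\<And>u. u \<in> ?V \<Longrightarrow> u \<in> Cl u"
      "\<And>u. u \<in> ?V \<Longrightarrow> card (Cl u) \<le> card (wreach G L1 r u) * (r + 1)"
      "\<And>u v. u \<in> ?V \<Longrightarrow> v \<in> ?V \<Longrightarrow> linked G ?V r u v \<Longrightarrow> linked G (Cl u \<union> Cl v) r u v"
      by (rule wreach_closure[OF fin, of L1 r]) (rule that)
    obtain c :: "'a \<Rightarrow> nat" where c: "c ` ?V \<subseteq> {..w2}"
      "\<And>u v. v \<in> ?V \<Longrightarrow> u \<in> wreach G L2 (2 ^ Suc q) v \<Longrightarrow> u \<noteq> v \<Longrightarrow> c u \<noteq> c v"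
      by (rule wreach_colouring[OF fin L2(1) L2(2)]) blast+
    define col where "col u = code (c ` Cl u)" for u
    have cCl: "c ` Cl u \<in> Pow {..w2}" if "u \<in> ?V" for u using c(1) Cl(1)[OF that] by blast
    have "col ` ?V \<subseteq> {..<card (Pow {..w2})}"
      using cCl bij_betwE[OF code] unfolding col_def by blast
    moreover have "rank_width (induced_subgraph (graph_power G r) X) \<le> 2 ^ ((w2 + 1) * (r + 1))"
      if X: "X \<subseteq> ?V" "card (col ` X) \<le> i" for X
    proof -
      let ?H = "induced_subgraph (graph_power G r) X"
      define Y where "Y = (\<Union>u\<in>X. Cl u)"
      have YV: "Y \<subseteq> ?V" using Cl(1) X(1) by (auto simp: Y_def)
      have finY: "finite Y" "finite X" using YV X(1) fin finite_subset by auto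
      have XY: "X \<subseteq> Y" using Cl(2) X(1) by (auto simp: Y_def)
      have VH: "vertices ?H = X" using X(1) by (auto simp: induced_subgraph_def graph_power_def)
      have "card (c ` Y) \<le> q"
      proof -
        let ?S = "(\<lambda>u. c ` Cl u) ` X"
        have "col ` X = code ` ?S" by (auto simp: col_def image_image)
        moreover have "inj_on code ?S"
          using bij_betw_imp_inj_on[OF code] cCl X(1) by (rule_tac inj_on_subset) auto
        ultimately have cardS: "card ?S \<le> i" using X(2) by (simp add: card_image)
        have small: "card s \<le> w1 * (r + 1)" if s: "s \<in> ?S" for s
        proof -
          obtain u where u: "u \<in> X" "s = c ` Cl u" using s by blast
          then have uV: "u \<in> ?V" using X(1) by blast
          have "card s \<le> card (Cl u)"
            unfolding u(2) using finite_subset[OF Cl(1)[OF uV] fin] by (rule card_image_le)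
          also have "\<dots> \<le> card (wreach G L1 r u) * (r + 1)" by (rule Cl(3)[OF uV])
          also have "\<dots> \<le> w1 * (r + 1)" using L1(2)[OF uV] by (rule mult_right_mono) simp
          finally show ?thesis .
        qed
        have "c ` Y = (\<Union>s\<in>?S. s)" by (auto simp: Y_def)
        then have "card (c ` Y) \<le> (\<Sum>s\<in>?S. card s)" using card_UN_le[of ?S "\<lambda>s. s"] finY by simp
        also have "\<dots> \<le> (\<Sum>s\<in>?S. w1 * (r + 1))" using small by (rule sum_mono)
        also have "\<dots> \<le> q" unfolding q_def using cardS by simp
        finally show ?thesis .
      qed
      then have anc: "anc G Y L2 v \<subseteq> wreach G L2 (2 ^ Suc q) v" for v
        by (intro anc_subset_wreach[OF YV finY(1), of L2 q c v] c(2)) auto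
      show ?thesis
      proof (rule rank_width_le_of_elimination[OF finY(1) inj_on_subset[OF L2(1) YV]])
        fix v assume "v \<in> Y"
        then have "v \<in> ?V" using YV by blast
        have "card (anc G Y L2 v) \<le> card (wreach G L2 (2 ^ Suc q) v)"
          using anc finite_subset[OF wreach_subset fin] by (intro card_mono)
        then show "card (anc G Y L2 v) \<le> w2" using L2(2)[OF \<open>v \<in> ?V\<close>] by simp
      next
        show "vertices ?H \<subseteq> Y" using VH XY by simp
        fix u v assume "u \<in> vertices ?H" "v \<in> vertices ?H" "u \<noteq> v"
        then have uv: "u \<in> X" "v \<in> X" "u \<noteq> v" "u \<in> ?V" "v \<in> ?V" using VH X(1) by auto
        have "{u, v} \<in> edges ?H \<longleftrightarrow> {u, v} \<in> edges (graph_power G r)"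
          using uv by (simp add: induced_subgraph_def)
        also have "\<dots> \<longleftrightarrow> linked G ?V r u v" by (rule graph_power_edge_iff[OF uv(4,5,3)])
        also have "\<dots> \<longleftrightarrow> linked G Y r u v"
        proof
          assume "linked G ?V r u v"
          then have "linked G (Cl u \<union> Cl v) r u v" by (rule Cl(4)[OF uv(4,5)])
          moreover have "Cl u \<union> Cl v \<subseteq> Y" using uv by (auto simp: Y_def)
          ultimately show "linked G Y r u v" by (rule linked_mono[OF _ order_refl])
        next
          assume "linked G Y r u v"
          then show "linked G ?V r u v" using YV by (rule linked_mono[OF _ order_refl])
        qed
        finally show "{u, v} \<in> edges ?H \<longleftrightarrow> linked G Y r u v" .
      qed
    qed
    ultimately show "\<exists>col :: 'a \<Rightarrow> nat. col ` ?V \<subseteq> {..<card (Pow {..w2})} \<and>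
        (\<forall>X\<subseteq>?V. card (col ` X) \<le> i \<longrightarrow>
          rank_width (induced_subgraph (graph_power G r) X) \<le> 2 ^ ((w2 + 1) * (r + 1)))"
      by (intro exI[of _ col]) simp
  qed
qed

theorem theorem2:
  fixes C :: "'a graph set" and r :: nat
  assumes "\<And>G. G \<in> C \<Longrightarrow> simple_graph G"
    and "bounded_expansion C"
    and "r \<ge> 2"
  shows "low_rank_width_colorings {graph_power G r | G. G \<in> C}"
proof -
  have "\<exists>N Q :: nat. \<forall>G\<in>C. \<exists>col :: 'a \<Rightarrow> nat. col ` vertices G \<subseteq> {..<N} \<and>
      (\<forall>X\<subseteq>vertices G. card (col ` X) \<le> i \<longrightarrow> rank_width (induced_subgraph (graph_power G r) X) \<le> Q)" for i
    by (rule power_colouring[OF assms(1,2), of i r]) blast+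
  then obtain N Q :: "nat \<Rightarrow> nat" where NQ: "\<And>i. \<forall>G\<in>C. \<exists>col :: 'a \<Rightarrow> nat. col ` vertices G \<subseteq> {..<N i} \<and>
      (\<forall>X\<subseteq>vertices G. card (col ` X) \<le> i \<longrightarrow>
        rank_width (induced_subgraph (graph_power G r) X) \<le> Q i)"
    by metis
  \<comment> \<open>The number of values of the product of the colourings for all \<open>i\<close>
    up to \<open>p\<close>.\<close>
  define M where "M p = card (PiE {..p} (\<lambda>i. {..<N i}))" for p :: nat
  have colouring: "\<exists>col :: 'a \<Rightarrow> nat. col ` vertices (graph_power G r) \<subseteq> {..<M p} \<and>
      (\<forall>I. I \<subseteq> {..<M p} \<and> card I \<le> p \<longrightarrow>
         rank_width (induced_subgraph (graph_power G r) {v \<in> vertices (graph_power G r). col v \<in> I}) \<le> Q (card I))"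
    if G: "G \<in> C" for G and p :: nat
  proof -
    let ?V = "vertices G"
    have V: "vertices (graph_power G r) = ?V" by (simp add: graph_power_def)
    have "\<forall>i. \<exists>col :: 'a \<Rightarrow> nat. col ` ?V \<subseteq> {..<N i} \<and>
      (\<forall>X\<subseteq>?V. card (col ` X) \<le> i \<longrightarrow> rank_width (induced_subgraph (graph_power G r) X) \<le> Q i)"
      using NQ G by blast
    then obtain col :: "nat \<Rightarrow> 'a \<Rightarrow> nat" where col: "\<forall>i. col i ` ?V \<subseteq> {..<N i} \<and>
      (\<forall>X\<subseteq>?V. card (col i ` X) \<le> i \<longrightarrow> rank_width (induced_subgraph (graph_power G r) X) \<le> Q i)"
      by metis
    let ?P = "PiE {..p} (\<lambda>i. {..<N i})"
    have "finite ?P" by (intro finite_PiE) auto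
    then obtain code :: "(nat \<Rightarrow> nat) \<Rightarrow> nat" where code: "bij_betw code ?P {..<M p}"
      unfolding M_def using ex_bij_betw_finite_nat lessThan_atLeast0 by metis
    define g where "g v = (\<lambda>i\<in>{..p}. col i v)" for v
    have gP: "g v \<in> ?P" if "v \<in> ?V" for v using col that unfolding g_def by fastforce
    have "code (g v) \<in> {..<M p}" if "v \<in> ?V" for v using bij_betwE[OF code] gP[OF that] by blast
    moreover have "rank_width (induced_subgraph (graph_power G r) {v \<in> ?V. code (g v) \<in> I}) \<le> Q (card I)"
      if I: "I \<subseteq> {..<M p}" "card I \<le> p" for I
    proof -
      let ?X = "{v \<in> ?V. code (g v) \<in> I}"
      let ?i = "card I"
      \<comment> \<open>The product colour determines the colour for the index
        \<open>card I\<close>, which is at most \<open>p\<close>. So \<open>card I\<close> product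
        classes show at most \<open>card I\<close> colours of that one colouring, whose bound does
        not depend on \<open>p\<close>.\<close>
      have "col ?i v = inv_into ?P code (code (g v)) ?i" if "v \<in> ?V" for v
        using bij_betw_inv_into_left[OF code gP[OF that]] I(2) by (simp add: g_def)
      then have "col ?i ` ?X \<subseteq> (\<lambda>x. inv_into ?P code x ?i) ` I" by auto
      moreover have "finite I" using I(1) finite_subset by blast
      ultimately have "card (col ?i ` ?X) \<le> ?i" by (meson surj_card_le)
      then show ?thesis using col by simp
    qed
    ultimately show ?thesis unfolding V by (intro exI[of _ "\<lambda>v. code (g v)"]) auto
  qed
  show ?thesis
    unfolding low_rank_width_colorings_def
  proof (rule exI[of _ M], rule exI[of _ Q], intro allI ballI)
    fix p D assume "D \<in> {graph_power G r | G. G \<in> C}"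
    then obtain G where D: "D = graph_power G r" "G \<in> C" by blast
    show "\<exists>col :: 'a \<Rightarrow> nat. col ` vertices D \<subseteq> {..<M p} \<and>
        (\<forall>I. I \<subseteq> {..<M p} \<and> card I \<le> p \<longrightarrow>
          rank_width (induced_subgraph D {v \<in> vertices D. col v \<in> I}) \<le> Q (card I))"
      unfolding D(1) by (rule colouring[OF D(2)])
  qed
qed

end
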